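(* Let $\Omega\subset\mathbb{R}^2$ be a region with smooth boundary which is homeomorphic to a disk with $k$ holes. Suppose that a collection of paths slits $\overline\Omega$. Then no strict subcollection of these paths slits $\overline\Omega$. Also, no strict supercollection of these paths (i.e. a strictly larger collection of paths which contains the original collection) slits $\overline\Omega$.
   Context: A region homeomorphic to a disk with $k$ holes and with smooth ($C^\infty$) boundary has boundary consisting of an outer component $\Sigma_0$ and $k$ interior components $\Sigma_1,\dots,\Sigma_k$, where $\Sigma_i$ is the boundary of the $i$-th hole. A path in $X$ is a piecewise smooth mapping $\gamma:[0,1]\to X$. A set $\mathcal N$ slits $\overline\Omega$ if it is the union of a collection of piecewise smooth, immersed lines such that: (1) each line starts and finishes at the boundary $\partial\Omega$ and leaves the boundary transversally; (2) internal intersections between lines are transversal; (3) the complement $\Omega\setminus\mathcal N$ is connected; (4) an odd number of the lines leaves each interior boundary component $\Sigma_1,\dots,\Sigma_k$. A collection of paths slits $\overline\Omega$ if the union of the images of the paths slits $\overline\Omega$, the images of the paths being the lines in the preceding definition.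
   Formalization: Collections of paths are required to be countable, since for uncountable ones the claim fails (chords sweeping out half a disk); the region is taken bounded, as its outer boundary component presupposes; internal intersections include self-intersections of a line. *)

theory Defs
  imports "HOL-Analysis.Analysis"
begin

section \<open>Piecewise smooth paths\<close>

text \<open>
  \<open>C_infinity_on S f\<close>: \<open>f\<close> has derivatives of all orders on \<open>S\<close>, the function \<open>D n\<close> being the
  \<open>n\<close>-th one. They are taken within \<open>S\<close>, hence are one-sided at the end points of an interval.
\<close>

definition C_infinity_on :: "real set \<Rightarrow> (real \<Rightarrow> 'a::real_normed_vector) \<Rightarrow> bool" where
  "C_infinity_on S f \<longleftrightarrow>
     (\<exists>D :: nat \<Rightarrow> real \<Rightarrow> 'a.
        (\<forall>t\<in>S. D 0 t = f t) \<and>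
        (\<forall>n. \<forall>t\<in>S. (D n has_vector_derivative D (Suc n) t) (at t within S)))"

text \<open>\<open>P\<close> is the set of break points: \<open>g\<close> is smooth between any two consecutive ones.\<close>

definition piecewise_smooth_path :: "(real \<Rightarrow> 'a::real_normed_vector) \<Rightarrow> bool" where
  "piecewise_smooth_path g \<longleftrightarrow>
     path g \<and>
     (\<exists>P. finite P \<and> {0, 1} \<subseteq> P \<and> P \<subseteq> {0..1} \<and>
          (\<forall>a\<in>P. \<forall>b\<in>P. a < b \<and> P \<inter> {a<..<b} = {} \<longrightarrow> C_infinity_on {a..b} g))"

definition smooth_path_in :: "'a::real_normed_vector set \<Rightarrow> (real \<Rightarrow> 'a) \<Rightarrow> bool" where
  "smooth_path_in X g \<longleftrightarrow> piecewise_smooth_path g \<and> path_image g \<subseteq> X"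

text \<open>
  The velocities of \<open>g\<close> at \<open>t\<close>: its right and its left derivative. For a piecewise smooth path
  they exist, and they differ only at break points.
\<close>

definition velocities :: "(real \<Rightarrow> 'a::real_normed_vector) \<Rightarrow> real \<Rightarrow> 'a set" where
  "velocities g t =
     {v. t < 1 \<and> (g has_vector_derivative v) (at t within {t..1}) \<or>
         0 < t \<and> (g has_vector_derivative v) (at t within {0..t})}"

definition immersed :: "(real \<Rightarrow> 'a::real_normed_vector) \<Rightarrow> bool" where
  "immersed g \<longleftrightarrow> (\<forall>t\<in>{0..1}. 0 \<notin> velocities g t)"


section \<open>Planar regions\<close>

definition disk_with_holes :: "nat \<Rightarrow> (real ^ 2) set \<Rightarrow> bool" where
  "disk_with_holes k D \<longleftrightarrow>
     (\<exists>(c :: nat \<Rightarrow> real ^ 2) r.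
        (\<forall>i<k. 0 < r i \<and> cball (c i) (r i) \<subseteq> ball 0 1) \<and>
        (\<forall>i<k. \<forall>j<k. i \<noteq> j \<longrightarrow> cball (c i) (r i) \<inter> cball (c j) (r j) = {}) \<and>
        D = ball 0 1 - (\<Union>i<k. cball (c i) (r i)))"

text \<open>
  Near each boundary point, \<open>\<Omega>\<close> is the part of the plane strictly above the graph of a smooth
  function, in suitable orthonormal coordinates \<open>x \<bullet> e\<close> and \<open>x \<bullet> n\<close>.
\<close>

definition smooth_boundary :: "(real ^ 2) set \<Rightarrow> bool" where
  "smooth_boundary \<Omega> \<longleftrightarrow>
     (\<forall>p\<in>frontier \<Omega>. \<exists>r>0. \<exists>(e :: real ^ 2) n f.
        norm e = 1 \<and> norm n = 1 \<and> e \<bullet> n = 0 \<and> C_infinity_on UNIV f \<and>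
        \<Omega> \<inter> ball p r = {x \<in> ball p r. f (x \<bullet> e) < x \<bullet> n})"

text \<open>
  Boundedness is part of the definition: the exterior of a closed disk is also homeomorphic to a
  disk with one hole, but its boundary has no outer component.
\<close>

definition smooth_region_with_holes :: "nat \<Rightarrow> (real ^ 2) set \<Rightarrow> bool" where
  "smooth_region_with_holes k \<Omega> \<longleftrightarrow>
     open \<Omega> \<and> connected \<Omega> \<and> bounded \<Omega> \<and> smooth_boundary \<Omega> \<and>
     (\<exists>D. disk_with_holes k D \<and> \<Omega> homeomorphic D)"

text \<open>
  The \<open>k\<close> holes are the bounded components of the complement; the unbounded component is bordered
  by the outer boundary component.
\<close>

definition holes :: "(real ^ 2) set \<Rightarrow> (real ^ 2) set set" where
  "holes \<Omega> = {H \<in> components (- \<Omega>). bounded H}"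

definition interior_boundary_components :: "(real ^ 2) set \<Rightarrow> (real ^ 2) set set" where
  "interior_boundary_components \<Omega> = frontier ` holes \<Omega>"


section \<open>Slitting\<close>

text \<open>
  Velocities at \<open>p\<close> of curves contained in \<open>S\<close>; for a smooth curve \<open>S\<close> in the plane, this is the
  tangent line of \<open>S\<close> at \<open>p\<close>, as a linear subspace.
\<close>

definition tangent_vectors :: "'a::real_normed_vector set \<Rightarrow> 'a \<Rightarrow> 'a set" where
  "tangent_vectors S p =
     {v. \<exists>c :: real \<Rightarrow> 'a. range c \<subseteq> S \<and> c 0 = p \<and> (c has_vector_derivative v) (at 0)}"

definition transversal_to_boundary :: "(real ^ 2) set \<Rightarrow> (real \<Rightarrow> real ^ 2) \<Rightarrow> bool" where
  "transversal_to_boundary \<Omega> g \<longleftrightarrow>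
     (\<forall>t\<in>{0..1}. g t \<in> frontier \<Omega> \<longrightarrow>
        (\<forall>v \<in> velocities g t. span (insert v (tangent_vectors (frontier \<Omega>) (g t))) = UNIV))"

text \<open>
  This covers intersections of two different lines and self-intersections of a line. At a break
  point, all one-sided velocities have to be transversal to those of the other branch.
\<close>

definition internally_transversal :: "(real ^ 2) set \<Rightarrow> (real \<Rightarrow> real ^ 2) set \<Rightarrow> bool" where
  "internally_transversal \<Omega> \<Gamma> \<longleftrightarrow>
     (\<forall>g\<in>\<Gamma>. \<forall>h\<in>\<Gamma>. \<forall>s\<in>{0..1}. \<forall>t\<in>{0..1}.
        (g, s) \<noteq> (h, t) \<and> g s = h t \<and> g s \<in> \<Omega> \<longrightarrow>
        (\<forall>v \<in> velocities g s. \<forall>w \<in> velocities h t. span {v, w} = UNIV))"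

text \<open>
  The collection \<open>\<Gamma>\<close> of paths slits the closure of \<open>\<Omega>\<close>. Some bound on the size of \<open>\<Gamma>\<close> is needed:
  an uncountable family of parallel chords can sweep out one half of a disk, leaving a connected
  complement. An infinite set has cardinality 0 here, so the last condition includes that the
  number of lines at each interior boundary component is finite.
\<close>

definition slits :: "(real \<Rightarrow> real ^ 2) set \<Rightarrow> (real ^ 2) set \<Rightarrow> bool" where
  "slits \<Gamma> \<Omega> \<longleftrightarrow>
     countable \<Gamma> \<and>
     (\<forall>g\<in>\<Gamma>. smooth_path_in (closure \<Omega>) g \<and> immersed g \<and>
            pathstart g \<in> frontier \<Omega> \<and> pathfinish g \<in> frontier \<Omega> \<and>
            transversal_to_boundary \<Omega> g) \<and>
     internally_transversal \<Omega> \<Gamma> \<and>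
     connected (\<Omega> - (\<Union>g\<in>\<Gamma>. path_image g)) \<and>
     (\<forall>S \<in> interior_boundary_components \<Omega>.
        odd (card {g \<in> \<Gamma>. pathstart g \<in> S \<or> pathfinish g \<in> S}))"

end

theory Submission
  imports Defs
begin

text \<open>
  Contract each component of the complement of \<open>\<Omega>\<close> to a point and regard the lines as edges between
  these points, with a further vertex at each crossing. If the lines do not disconnect \<open>\<Omega>\<close>, then this
  planar graph has no cycle; in particular, no nonempty set of lines is a cycle modulo 2. Now let
  \<open>\<Gamma> \<subset> \<Gamma>'\<close> both slit. At every hole both collections have an odd number of lines, so that the lines in
  \<open>\<Gamma>' - \<Gamma>\<close> have an even number of ends there. They form a nonzero cycle modulo 2, which is absurd. This
  excludes a strict supercollection and, with the roles exchanged, a strict subcollection.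

  No graph is needed to make this precise. Suppose that a finite nonempty set \<open>\<Delta>\<close> of lines does not
  disconnect \<open>\<Omega>\<close>, and let \<open>g \<in> \<Delta>\<close>. The lines cross transversally, hence in countably many points, and
  so \<open>g\<close> has a point \<open>p \<in> \<Omega>\<close> that it visits only once, that lies on no other line, and at which it has a
  nonzero velocity (\<open>regular_point\<close>). A short segment across \<open>g\<close> at \<open>p\<close> has its ends off the
  lines, in a connected open set. Joining the ends there gives a Jordan curve in \<open>\<Omega>\<close> that meets the lines only in
  \<open>p\<close>. Its inside \<open>I\<close> contains exactly one end of \<open>g\<close> and an even number of ends of every other line
  (\<open>separating_domain\<close>). So the number of ends in \<open>I\<close> is odd. On the other hand, \<open>I\<close> is bounded, and each
  component of \<open>- \<Omega>\<close> lies in \<open>I\<close> or misses it; hence this number is the sum of the numbers of ends at the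
  holes in \<open>I\<close>. So \<open>\<Delta>\<close> has an odd number of ends at some hole (\<open>slits_subfamily_odd_at_some_hole\<close>).

  The definition counts lines, not ends, at a hole. Applied to a single line, the above shows that a
  line never has both ends at the same component of the complement, so that the two numbers agree, and
  also that every line has an end at some hole, so that \<open>\<Gamma>' - \<Gamma>\<close> is finite.
\<close>

section \<open>Jordan curves across a slit\<close>

text \<open>
How a connected complement \<open>W\<close> produces a loop across one of the slits: when \<open>W\<close> contains a
segment except for its midpoint \<open>p\<close>, the two ends of the segment are joined by an arc in \<open>W\<close>, and
closing that arc up along the segment gives a Jordan curve that leaves \<open>W\<close> only at \<open>p\<close>. The arc may
hit the segment many times; only its part between the last visit to the half on the side of \<open>d\<close> and
the next visit to the other half is kept. The arc stays away from \<open>p\<close>, so that the curve is straight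
near \<open>p\<close>.
\<close>

lemma loop_through_cut:
  fixes W :: "(real ^ 2) set"
  assumes "open W" "connected W" "d \<noteq> 0" "p \<notin> W"
    and seg: "\<And>s::real. s \<noteq> 0 \<Longrightarrow> \<bar>s\<bar> \<le> 1 \<Longrightarrow> p + s *\<^sub>R d \<in> W"
  obtains J \<eta> where "J homeomorphic sphere (0::real^2) 1" "J \<subseteq> insert p W" "0 < \<eta>"
    "ball p \<eta> \<inter> J = ball p \<eta> \<inter> range (\<lambda>s. p + s *\<^sub>R d)"
proof -
  have "path_connected W"
    using assms connected_open_path_connected by blast
  moreover have "p + d \<in> W" "p - d \<in> W"
    using seg[of 1] seg[of "-1"] by auto
  moreover have "p + d \<noteq> p - d"
  proof
    assume "p + d = p - d"
    then have "2 *\<^sub>R d = 0" by (simp add: scaleR_2 algebra_simps)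
    then show False using \<open>d \<noteq> 0\<close> by simp
  qed
  ultimately obtain \<sigma> where \<sigma>: "arc \<sigma>" "path_image \<sigma> \<subseteq> W" "pathstart \<sigma> = p + d" "pathfinish \<sigma> = p - d"
    unfolding path_connected_arcwise by metis
  have inj\<sigma>: "inj_on \<sigma> {0..1}" and cont\<sigma>: "continuous_on {0..1} \<sigma>"
    using \<sigma>(1) by (auto simp: arc_def path_def)
  define X where "X = closed_segment p (p + d)"
  define Y where "Y = closed_segment p (p - d)"
  have Xeq: "X = (\<lambda>s. p + s *\<^sub>R d) ` {0..1}"
    by (auto simp: X_def closed_segment_def image_iff algebra_simps intro!: bexI)
  have Yeq: "Y = (\<lambda>s. p + s *\<^sub>R d) ` {-1..0}"
  proof -
    have "Y = (\<lambda>s. p + s *\<^sub>R d) ` (uminus ` {0..1})"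
      unfolding image_image by (auto simp: Y_def closed_segment_def image_iff algebra_simps intro!: bexI)
    then show ?thesis by simp
  qed
  have sub: "\<sigma> t \<in> W" if "t \<in> {0..1}" for t
    using \<sigma>(2) that by (auto simp: path_image_def)
  have cX: "compact ({0..1} \<inter> \<sigma> -` X)"
    by (metis X_def closed_segment compact_Icc compact_Int_closed compact_eq_bounded_closed bounded_Int cont\<sigma>
        continuous_closed_preimage closed_atLeastAtMost)
  have "0 \<in> {0..1} \<inter> \<sigma> -` X"
    using \<sigma>(3) by (auto simp: pathstart_def X_def)
  (* the last visit to the half on the side of d *)
  then obtain u where u: "u \<in> {0..1}" "\<sigma> u \<in> X" "\<And>t. t \<in> {0..1} \<Longrightarrow> \<sigma> t \<in> X \<Longrightarrow> t \<le> u"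
    using compact_attains_sup[OF cX] by blast
  have cY: "compact ({u..1} \<inter> \<sigma> -` Y)"
  proof -
    have "continuous_on {u..1} \<sigma>" using cont\<sigma> u(1) by (auto intro: continuous_on_subset)
    then have "closed ({u..1} \<inter> \<sigma> -` Y)"
      unfolding Y_def by (simp add: continuous_closed_preimage)
    then show ?thesis by (simp add: compact_eq_bounded_closed bounded_Int)
  qed
  have "1 \<in> {u..1} \<inter> \<sigma> -` Y"
    using \<sigma>(4) u(1) by (auto simp: pathfinish_def Y_def)
  (* the first visit to the other half after that *)
  then obtain v where v: "v \<in> {u..1}" "\<sigma> v \<in> Y" "\<And>t. t \<in> {u..1} \<Longrightarrow> \<sigma> t \<in> Y \<Longrightarrow> v \<le> t"
    using compact_attains_inf[OF cY] by blast
  have v01: "v \<in> {0..1}" using u(1) v(1) by auto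
  obtain a where a: "0 \<le> a" "a \<le> 1" "\<sigma> u = p + a *\<^sub>R d" using u(2) Xeq by auto
  obtain b where b: "-1 \<le> b" "b \<le> 0" "\<sigma> v = p + b *\<^sub>R d" using v(2) Yeq by auto
  have "a \<noteq> 0" using a sub[OF u(1)] \<open>p \<notin> W\<close> by auto
  then have a0: "0 < a" using a by simp
  have "b \<noteq> 0" using b sub[OF v01] \<open>p \<notin> W\<close> by auto
  then have b0: "b < 0" using b by simp
  have "\<sigma> u \<noteq> \<sigma> v" using a b a0 b0 \<open>d \<noteq> 0\<close> by auto
  then have uv: "u < v" using v(1) by (cases "u = v") auto
  define \<tau> where "\<tau> = subpath u v \<sigma>"
  define l where "l = linepath (\<sigma> v) (\<sigma> u)"
  have \<tau>: "arc \<tau>" unfolding \<tau>_def using \<sigma>(1) u(1) v01 uv by (simp add: arc_subpath_arc)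
  have l: "arc l" unfolding l_def using \<open>\<sigma> u \<noteq> \<sigma> v\<close> by auto
  have im\<tau>: "path_image \<tau> = \<sigma> ` {u..v}" unfolding \<tau>_def using uv by (simp add: path_image_subpath)
  have iml: "path_image l = (\<lambda>s. p + s *\<^sub>R d) ` {b..a}"
  proof -
    have "path_image l = (\<lambda>s. p + s *\<^sub>R d) ` closed_segment b a"
    proof -
      have "(1 - t) *\<^sub>R \<sigma> v + t *\<^sub>R \<sigma> u = p + ((1 - t) *\<^sub>R b + t *\<^sub>R a) *\<^sub>R d" for t
        using a b by (simp add: algebra_simps)
      then show ?thesis unfolding l_def path_image_linepath
        by (auto simp: closed_segment_def image_iff)
    qed
    then show ?thesis using a0 b0 by (simp add: closed_segment_eq_real_ivl)
  qed
  have inter: "path_image \<tau> \<inter> path_image l \<subseteq> {\<sigma> u, \<sigma> v}"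
  proof
    fix x assume "x \<in> path_image \<tau> \<inter> path_image l"
    then obtain t s where t: "t \<in> {u..v}" "x = \<sigma> t" and s: "s \<in> {b..a}" "x = p + s *\<^sub>R d"
      unfolding im\<tau> iml by blast
    have t01: "t \<in> {0..1}" using t u(1) v01 by auto
    show "x \<in> {\<sigma> u, \<sigma> v}"
    proof (cases "0 \<le> s")
      case True
      then have "\<sigma> t \<in> X" using s t a unfolding Xeq by auto
      then have "t = u" using u(3)[OF t01] t(1) by auto
      then show ?thesis using t by simp
    next
      case False
      then have "\<sigma> t \<in> Y" using s t b unfolding Yeq by auto
      then have "t = v" using v(3)[of t] t(1) v01 by auto
      then show ?thesis using t by simp
    qed
  qed
  have ends: "pathstart \<tau> = \<sigma> u" "pathfinish \<tau> = \<sigma> v" "pathstart l = \<sigma> v" "pathfinish l = \<sigma> u"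
    by (auto simp: \<tau>_def l_def)
  define J where "J = path_image \<tau> \<union> path_image l"
  have "simple_path (\<tau> +++ l)"
    by (rule simple_path_join_loop) (use \<tau> l inter ends in auto)
  moreover have "path_image (\<tau> +++ l) = J"
    using ends by (simp add: J_def path_image_join)
  moreover have "pathfinish (\<tau> +++ l) = pathstart (\<tau> +++ l)"
    using ends by simp
  ultimately have "J homeomorphic sphere (0::complex) 1"
    using homeomorphic_simple_path_image_circle[of "\<tau> +++ l" 1 0] by auto
  moreover have "sphere (0::complex) 1 homeomorphic sphere (0::real^2) 1"
    by (rule homeomorphic_spheres_gen) auto
  ultimately have J1: "J homeomorphic sphere (0::real^2) 1"
    using homeomorphic_trans by blast
  have p\<tau>: "p \<notin> path_image \<tau>"
    using sub \<open>p \<notin> W\<close> u(1) v01 unfolding im\<tau> by auto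
  have J2: "J \<subseteq> insert p W"
  proof -
    have "path_image \<tau> \<subseteq> W" using sub u(1) v01 unfolding im\<tau> by auto
    moreover have "p + s *\<^sub>R d \<in> insert p W" if "s \<in> {b..a}" for s
      using seg[of s] that a(2) b(1) by (cases "s = 0") (auto simp: abs_le_iff)
    ultimately show ?thesis unfolding J_def iml by blast
  qed
  have "closed (path_image \<tau>)" using \<tau> arc_imp_path closed_path_image by blast
  then obtain r where r: "0 < r" "ball p r \<subseteq> - path_image \<tau>"
    using p\<tau> open_contains_ball[of "- path_image \<tau>"] by (auto simp: open_Compl)
  define \<eta> where "\<eta> = min r (min (a * norm d) (- b * norm d))"
  have \<eta>0: "0 < \<eta>" using r a0 b0 \<open>d \<noteq> 0\<close> by (simp add: \<eta>_def mult_neg_pos)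
  have "ball p \<eta> \<inter> J = ball p \<eta> \<inter> range (\<lambda>s. p + s *\<^sub>R d)"
  proof -
    have "ball p \<eta> \<inter> path_image \<tau> = {}" using r by (auto simp: \<eta>_def)
    moreover have "s \<in> {b..a}" if "p + s *\<^sub>R d \<in> ball p \<eta>" for s
    proof -
      have *: "\<bar>s\<bar> * norm d < \<eta>" using that by (simp add: dist_norm)
      then have "\<bar>s\<bar> * norm d < a * norm d" "\<bar>s\<bar> * norm d < - b * norm d" by (auto simp: \<eta>_def)
      then have "\<bar>s\<bar> < a" "\<bar>s\<bar> < - b" using \<open>d \<noteq> 0\<close> mult_right_less_imp_less norm_ge_zero by blast+
      then show ?thesis by auto
    qed
    ultimately show ?thesis unfolding J_def iml by auto
  qed
  then show thesis by (rule that[OF J1 J2 \<eta>0])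
qed

text \<open>
Every component of the complement of a Jordan curve has the whole curve as its frontier, so it meets
one of the two half disks at \<open>p\<close>, and then contains it. As there are at least two components, the
half disks lie in different ones; a bounded component \<open>I\<close> therefore contains exactly one
of them.
\<close>

lemma Jordan_curve_sides_of_straight_piece:
  fixes J :: "(real ^ 2) set"
  assumes J: "J homeomorphic sphere (0::real^2) 1" and \<eta>: "0 < \<eta>" and "v \<noteq> 0"
    and loc: "ball p \<eta> \<inter> J = ball p \<eta> \<inter> {x. (x - p) \<bullet> v = 0}"
  obtains I where "I \<in> components (- J)" "bounded I"
    "(\<forall>x\<in>ball p \<eta>. 0 < (x - p) \<bullet> v \<longrightarrow> x \<in> I) \<and> (\<forall>x\<in>ball p \<eta>. (x - p) \<bullet> v < 0 \<longrightarrow> x \<notin> I) \<or>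
     (\<forall>x\<in>ball p \<eta>. 0 < (x - p) \<bullet> v \<longrightarrow> x \<notin> I) \<and> (\<forall>x\<in>ball p \<eta>. (x - p) \<bullet> v < 0 \<longrightarrow> x \<in> I)"
proof -
  have pJ: "p \<in> J" using loc \<eta> by (metis (mono_tags, lifting) IntD2 IntI centre_in_ball cancel_comm_monoid_add_class.diff_cancel inner_zero_left mem_Collect_eq)
  have "compact J" using J homeomorphic_compactness compact_sphere by blast
  then have bJ: "bounded (- (- J))" by (simp add: compact_imp_bounded)
  obtain I where I: "I \<in> components (- J)" "bounded I"
    using cobounded_has_bounded_component[OF bJ] Jordan_Brouwer_separation[OF J] by auto
  obtain O' where O': "O' \<in> components (- J)" "O' \<noteq> I"
    using Jordan_Brouwer_separation[OF J] I(1) connected_eq_connected_components_eq[of "- J"] by auto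
  have fr: "frontier C = J" if "C \<in> components (- J)" for C
    using Jordan_Brouwer_frontier[OF J that] by simp
  define S1 where "S1 = ball p \<eta> \<inter> {x. v \<bullet> x > v \<bullet> p}"
  define S2 where "S2 = ball p \<eta> \<inter> {x. v \<bullet> x < v \<bullet> p}"
  have "convex S1" "convex S2" unfolding S1_def S2_def
    by (auto intro!: convex_Int convex_halfspace_gt convex_halfspace_lt)
  then have conn: "connected S1" "connected S2" by (auto intro: convex_connected)
  have "x \<in> J \<longleftrightarrow> (x - p) \<bullet> v = 0" if "x \<in> ball p \<eta>" for x
    using loc that by blast
  then have "x \<in> J \<longleftrightarrow> v \<bullet> x = v \<bullet> p" if "x \<in> ball p \<eta>" for x
    using that by (simp add: inner_diff_left inner_commute[of v])
  then have "S1 \<subseteq> - J" "S2 \<subseteq> - J"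
    by (auto simp: S1_def S2_def)
  then have dich: "S1 \<subseteq> C \<or> S1 \<inter> C = {}" "S2 \<subseteq> C \<or> S2 \<inter> C = {}" if "C \<in> components (- J)" for C
    using components_maximal[OF that conn(1)] components_maximal[OF that conn(2)] by (auto simp: Int_commute)
  have meets: "S1 \<inter> C \<noteq> {} \<or> S2 \<inter> C \<noteq> {}" if C: "C \<in> components (- J)" for C
  proof -
    have "p \<in> closure C" using fr[OF C] pJ by (auto simp: frontier_def)
    then obtain x where x: "x \<in> C" "x \<in> ball p \<eta>"
      using \<eta> by (metis closure_approachable dist_commute mem_ball)
    then have "x \<notin> J" using C in_components_subset by blast
    then have "(x - p) \<bullet> v \<noteq> 0" using loc x by blast
    then have "x \<in> S1 \<or> x \<in> S2" using x by (auto simp: S1_def S2_def algebra_simps inner_commute)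
    then show ?thesis using x by auto
  qed
  have disj: "I \<inter> O' = {}" using I(1) O' components_nonoverlap by metis
  have "S1 \<noteq> {} \<and> S2 \<noteq> {} \<Longrightarrow> (S1 \<subseteq> I \<and> S2 \<inter> I = {}) \<or> (S1 \<inter> I = {} \<and> S2 \<subseteq> I)"
    using dich[OF I(1)] dich[OF O'(1)] meets[OF I(1)] meets[OF O'(1)] disj by blast
  moreover have "S1 \<noteq> {} \<and> S2 \<noteq> {}"
  proof -
    define e where "e = \<eta> / (2 * norm v)"
    have e: "0 < e" "e * norm v < \<eta>" using \<eta> \<open>v \<noteq> 0\<close> by (auto simp: e_def)
    have "p + e *\<^sub>R v \<in> S1" "p - e *\<^sub>R v \<in> S2"
      using e \<open>v \<noteq> 0\<close> by (auto simp: S1_def S2_def dist_norm inner_add_right inner_diff_right)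
    then show ?thesis by blast
  qed
  ultimately have *: "(S1 \<subseteq> I \<and> S2 \<inter> I = {}) \<or> (S1 \<inter> I = {} \<and> S2 \<subseteq> I)" by blast
  have mem: "x \<in> S1 \<longleftrightarrow> x \<in> ball p \<eta> \<and> 0 < (x - p) \<bullet> v" "x \<in> S2 \<longleftrightarrow> x \<in> ball p \<eta> \<and> (x - p) \<bullet> v < 0" for x
    by (auto simp: S1_def S2_def algebra_simps inner_commute)
  show thesis
    by (rule that[OF I]) (use * mem in blast)
qed

lemma line_orthogonal_to_vector:
  fixes v :: "real ^ 2"
  assumes "v \<noteq> 0"
  shows "range (\<lambda>s. p + s *\<^sub>R vector [- v $ 2, v $ 1]) = {x. (x - p) \<bullet> v = 0}"
    and "(vector [- v $ 2, v $ 1] :: real ^ 2) \<noteq> 0"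
proof -
  let ?n = "vector [- v $ 2, v $ 1] :: real ^ 2"
  have v0: "v $ 1 \<noteq> 0 \<or> v $ 2 \<noteq> 0" using assms by (auto simp: vec_eq_iff forall_2)
  then have q: "0 < v $ 1 * v $ 1 + v $ 2 * v $ 2" (is "0 < ?q")
    by (metis add.commute sum_squares_gt_zero_iff)
  show "?n \<noteq> 0" using v0 by (auto simp: vec_eq_iff forall_2)
  have "\<exists>s. x = p + s *\<^sub>R ?n" if "(x - p) \<bullet> v = 0" for x
  proof -
    define y where "y = x - p"
    have y: "y $ 1 * v $ 1 + y $ 2 * v $ 2 = 0" using that by (simp add: y_def inner_vec_def sum_2)
    define s where "s = (y $ 2 * v $ 1 - y $ 1 * v $ 2) / ?q"
    have e: "y $ 1 * ?q = (y $ 2 * v $ 1 - y $ 1 * v $ 2) * - v $ 2"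
      "y $ 2 * ?q = (y $ 2 * v $ 1 - y $ 1 * v $ 2) * v $ 1"
      using y by algebra+
    have q0: "?q \<noteq> 0" by (rule less_imp_neq[OF q, symmetric])
    have "y $ 1 = s * - v $ 2" "y $ 2 = s * v $ 1"
      using nonzero_eq_divide_eq[OF q0, THEN iffD2, OF e(1)] nonzero_eq_divide_eq[OF q0, THEN iffD2, OF e(2)]
      by (simp_all only: s_def times_divide_eq_left)
    then have "y = s *\<^sub>R ?n" by (simp add: vec_eq_iff forall_2)
    then have "x = p + s *\<^sub>R ?n" by (simp add: y_def algebra_simps)
    then show ?thesis by blast
  qed
  moreover have "(p + s *\<^sub>R ?n - p) \<bullet> v = 0" for s by (simp add: inner_vec_def sum_2)
  ultimately show "range (\<lambda>s. p + s *\<^sub>R ?n) = {x. (x - p) \<bullet> v = 0}" by blast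
qed

text \<open>
The heart of the matter. Let \<open>\<tau>\<close> be a time at which \<open>g\<close> is alone at its position \<open>p\<close> and has a nonzero
velocity \<open>v\<close>. A short segment through \<open>p\<close> orthogonal to \<open>v\<close> meets the paths only at \<open>p\<close>. Since the
complement of the paths in \<open>\<Omega>\<close> is connected, the segment closes up to a Jordan curve in \<open>\<Omega>\<close> that
meets the paths only at \<open>p\<close>. Let \<open>I\<close> be a bounded component of its complement. Then \<open>g\<close> crosses the
curve exactly once, so that it has one end in \<open>I\<close>; the other paths do not cross it, so that both
their ends or none lie in \<open>I\<close>; neither do the components of \<open>- \<Omega>\<close>, each of which therefore
lies in \<open>I\<close>, and is then bounded like \<open>I\<close>, or misses it.
\<close>

lemma separating_domain:
  fixes \<Omega> :: "(real ^ 2) set" and \<Delta> :: "(real \<Rightarrow> real ^ 2) set"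
  assumes "open \<Omega>" "finite \<Delta>" and paths: "\<And>h. h \<in> \<Delta> \<Longrightarrow> path h"
    and conn: "connected (\<Omega> - (\<Union>h\<in>\<Delta>. path_image h))"
    and g: "g \<in> \<Delta>" and \<tau>: "0 < \<tau>" "\<tau> < 1" and "g \<tau> \<in> \<Omega>"
    and deriv: "(g has_vector_derivative v) (at \<tau>)" and "v \<noteq> 0"
    and simple: "\<And>h t. h \<in> \<Delta> \<Longrightarrow> t \<in> {0..1} \<Longrightarrow> h t = g \<tau> \<Longrightarrow> h = g \<and> t = \<tau>"
  obtains I where "\<And>h. h \<in> \<Delta> \<Longrightarrow> h \<noteq> g \<Longrightarrow> h 0 \<in> I \<longleftrightarrow> h 1 \<in> I"
    and "g 0 \<in> I \<longleftrightarrow> g 1 \<notin> I"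
    and "\<And>C. C \<in> components (- \<Omega>) \<Longrightarrow> C \<inter> I \<noteq> {} \<Longrightarrow> C \<subseteq> I \<and> bounded C"
proof -
  define p where "p = g \<tau>"
  (* the signed distance (up to a factor) of g from the line through p orthogonal to v *)
  define \<phi> where "\<phi> t = (g t - p) \<bullet> v" for t
  have "(\<phi> has_real_derivative v \<bullet> v) (at \<tau>)"
  proof -
    have "((\<lambda>t. g t - p) has_vector_derivative v - 0) (at \<tau>)"
      by (rule has_vector_derivative_diff[OF deriv has_vector_derivative_const])
    from bounded_linear.has_vector_derivative[OF bounded_linear_inner_left this, of v] show ?thesis
      unfolding has_real_derivative_iff_has_vector_derivative \<phi>_def by simp
  qed
  moreover have "0 < v \<bullet> v" using \<open>v \<noteq> 0\<close> by simp
  ultimately obtain \<epsilon>1 \<epsilon>2 where \<epsilon>1: "0 < \<epsilon>1" "\<And>h. 0 < h \<Longrightarrow> h < \<epsilon>1 \<Longrightarrow> \<phi> \<tau> < \<phi> (\<tau> + h)"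
    and \<epsilon>2: "0 < \<epsilon>2" "\<And>h. 0 < h \<Longrightarrow> h < \<epsilon>2 \<Longrightarrow> \<phi> (\<tau> - h) < \<phi> \<tau>"
    using DERIV_pos_inc_right DERIV_pos_inc_left by metis
  have \<phi>0: "\<phi> \<tau> = 0" by (simp add: \<phi>_def p_def)
  define \<epsilon> where "\<epsilon> = min (min \<epsilon>1 \<epsilon>2) (min \<tau> (1 - \<tau>))"
  have \<epsilon>: "0 < \<epsilon>" "\<epsilon> \<le> \<tau>" "\<epsilon> \<le> 1 - \<tau>" using \<epsilon>1(1) \<epsilon>2(1) \<tau> by (auto simp: \<epsilon>_def)
  have pos: "0 < \<phi> t" if "\<tau> < t" "t < \<tau> + \<epsilon>" for t
    using \<epsilon>1(2)[of "t - \<tau>"] that \<phi>0 by (simp add: \<epsilon>_def)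
  have neg: "\<phi> t < 0" if "\<tau> - \<epsilon> < t" "t < \<tau>" for t
    using \<epsilon>2(2)[of "\<tau> - t"] that \<phi>0 by (simp add: \<epsilon>_def)
  (* everything that the paths cover, except the short piece of g around \<tau> *)
  define K where "K = (\<Union>h\<in>\<Delta> - {g}. path_image h) \<union> g ` ({0..1} - {\<tau> - \<epsilon><..<\<tau> + \<epsilon>})"
  have contg: "continuous_on {0..1} g" using paths[OF g] by (simp add: path_def)
  have "closed K"
  proof -
    have "closed (\<Union>h\<in>\<Delta> - {g}. path_image h)"
      using \<open>finite \<Delta>\<close> paths by (intro closed_UN) (auto intro: closed_path_image)
    moreover have "compact ({0..1} - {\<tau> - \<epsilon><..<\<tau> + \<epsilon>})" by (intro compact_diff) auto
    then have "compact (g ` ({0..1} - {\<tau> - \<epsilon><..<\<tau> + \<epsilon>}))"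
      by (intro compact_continuous_image continuous_on_subset[OF contg]) auto
    ultimately show ?thesis unfolding K_def by (auto intro: compact_imp_closed)
  qed
  moreover have "p \<notin> K"
  proof
    assume "p \<in> K"
    then consider h where "h \<in> \<Delta>" "h \<noteq> g" "p \<in> path_image h" |
      t where "t \<in> {0..1}" "t \<notin> {\<tau> - \<epsilon><..<\<tau> + \<epsilon>}" "p = g t" unfolding K_def by blast
    then show False
    proof cases
      case 1
      then obtain t where "t \<in> {0..1}" "h t = g \<tau>" unfolding p_def path_image_def by force
      then show False using simple[OF 1(1)] 1(2) by blast
    next
      case 2
      then have "t = \<tau>" using simple[OF g 2(1)] by (simp add: p_def)
      then show False using 2(2) \<epsilon> by simp
    qed
  qed
  ultimately have "open (\<Omega> - K)" "p \<in> \<Omega> - K"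
    using \<open>open \<Omega>\<close> \<open>g \<tau> \<in> \<Omega>\<close> by (auto simp: p_def)
  then obtain \<rho> where \<rho>: "0 < \<rho>" "ball p \<rho> \<subseteq> \<Omega> - K" using open_contains_ball by blast
  define W where "W = \<Omega> - (\<Union>h\<in>\<Delta>. path_image h)"
  have onlyg: "t = \<tau>" if "h \<in> \<Delta>" "t \<in> {0..1}" "h t \<in> ball p \<rho>" "(h t - p) \<bullet> v = 0" for h t
  proof -
    have "h t \<notin> K" using that(3) \<rho> by blast
    then have "h = g" using that(1,2) unfolding K_def path_image_def by blast
    moreover have "t \<in> {\<tau> - \<epsilon><..<\<tau> + \<epsilon>}"
      using \<open>h t \<notin> K\<close> \<open>h = g\<close> that(2) unfolding K_def by blast
    ultimately have "h = g" "t \<in> {\<tau> - \<epsilon><..<\<tau> + \<epsilon>}" by auto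
    then show ?thesis using pos[of t] neg[of t] that(4) by (fastforce simp: \<phi>_def)
  qed
  define n :: "real ^ 2" where "n = vector [- v $ 2, v $ 1]"
  have nv: "n \<bullet> v = 0" by (simp add: n_def inner_vec_def sum_2)
  have line: "range (\<lambda>s. p + s *\<^sub>R n) = {x. (x - p) \<bullet> v = 0}" and "n \<noteq> 0"
    unfolding n_def by (rule line_orthogonal_to_vector[OF \<open>v \<noteq> 0\<close>])+
  (* short enough for the segment from p - d to p + d to stay in the disk ball p \<rho> *)
  define d where "d = (\<rho> / (2 * norm n)) *\<^sub>R n"
  have nd: "norm d = \<rho> / 2" "d \<noteq> 0" using \<open>n \<noteq> 0\<close> \<rho>(1) by (auto simp: d_def)
  have dv: "d \<bullet> v = 0" using nv by (simp add: d_def)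
  have lined: "range (\<lambda>s. p + s *\<^sub>R d) = {x. (x - p) \<bullet> v = 0}"
  proof -
    define c where "c = \<rho> / (2 * norm n)"
    have "c \<noteq> 0" using \<open>n \<noteq> 0\<close> \<rho>(1) by (simp add: c_def)
    then have "range (\<lambda>s. s * c) = UNIV" by (intro surjI[of _ "\<lambda>s. s / c"]) simp
    then have "range (\<lambda>s. p + s *\<^sub>R n) = (\<lambda>s. p + s *\<^sub>R n) ` range (\<lambda>s. s * c)" by simp
    also have "\<dots> = range (\<lambda>s. p + s *\<^sub>R d)" by (simp add: image_image d_def c_def)
    finally have "range (\<lambda>s. p + s *\<^sub>R n) = range (\<lambda>s. p + s *\<^sub>R d)" .
    then show ?thesis using line by simp
  qed
  have seg: "p + s *\<^sub>R d \<in> W" if "s \<noteq> 0" "\<bar>s\<bar> \<le> 1" for s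
  proof -
    have "\<bar>s\<bar> * norm d \<le> 1 * norm d" using that(2) by (intro mult_right_mono) auto
    then have "\<bar>s\<bar> * norm d < \<rho>" using nd(1) \<rho>(1) by linarith
    then have b: "p + s *\<^sub>R d \<in> ball p \<rho>" by (simp add: dist_norm)
    have "p + s *\<^sub>R d \<noteq> h t" if "h \<in> \<Delta>" "t \<in> {0..1}" for h t
    proof
      assume eq: "p + s *\<^sub>R d = h t"
      then have "h t - p = s *\<^sub>R d" by (metis add_diff_cancel_left')
      then have "t = \<tau>" using onlyg[OF that] b eq dv by simp
      moreover have "h t \<notin> K" using b eq \<rho>(2) by auto
      then have "h = g" using that unfolding K_def path_image_def by blast
      ultimately show False using eq \<open>s \<noteq> 0\<close> nd(2) by (simp add: p_def)
    qed
    then show ?thesis using b \<rho>(2) unfolding W_def path_image_def by blast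
  qed
  have "p \<in> path_image g" using \<tau> unfolding p_def path_image_def by auto
  then have "p \<notin> W" using g unfolding W_def by blast
  have "closed (\<Union>h\<in>\<Delta>. path_image h)"
    using \<open>finite \<Delta>\<close> paths by (intro closed_UN) (auto intro: closed_path_image)
  then have "open W" unfolding W_def using \<open>open \<Omega>\<close> by blast
  obtain J \<eta> where J: "J homeomorphic sphere (0::real^2) 1" "J \<subseteq> insert p W" "0 < \<eta>"
    "ball p \<eta> \<inter> J = ball p \<eta> \<inter> range (\<lambda>s. p + s *\<^sub>R d)"
    using loop_through_cut[OF \<open>open W\<close> conn[folded W_def] nd(2) \<open>p \<notin> W\<close> seg] by blast
  obtain I where I: "I \<in> components (- J)" "bounded I" and sides:
    "(\<forall>x\<in>ball p \<eta>. 0 < (x - p) \<bullet> v \<longrightarrow> x \<in> I) \<and> (\<forall>x\<in>ball p \<eta>. (x - p) \<bullet> v < 0 \<longrightarrow> x \<notin> I) \<or>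
     (\<forall>x\<in>ball p \<eta>. 0 < (x - p) \<bullet> v \<longrightarrow> x \<notin> I) \<and> (\<forall>x\<in>ball p \<eta>. (x - p) \<bullet> v < 0 \<longrightarrow> x \<in> I)"
    using Jordan_curve_sides_of_straight_piece[OF J(1,3) \<open>v \<noteq> 0\<close>] J(4) unfolding lined by blast
  have same: "X \<subseteq> I \<or> X \<inter> I = {}" if "connected X" "X \<inter> J = {}" for X
    using components_maximal[OF I(1) that(1)] that(2) by blast
  have "J \<subseteq> \<Omega>" using J(2) \<open>g \<tau> \<in> \<Omega>\<close> by (auto simp: p_def W_def)
  show thesis
  proof (rule that)
    fix h assume h: "h \<in> \<Delta>" "h \<noteq> g"
    have "p \<notin> path_image h" using \<open>p \<notin> K\<close> h unfolding K_def by blast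
    then have "path_image h \<inter> J = {}" using J(2) h(1) unfolding W_def by blast
    moreover have "connected (path_image h)" using paths[OF h(1)] by (rule connected_path_image)
    ultimately have "path_image h \<subseteq> I \<or> path_image h \<inter> I = {}" using same by blast
    moreover have "h 0 \<in> path_image h" "h 1 \<in> path_image h" by (auto simp: path_image_def)
    ultimately show "h 0 \<in> I \<longleftrightarrow> h 1 \<in> I" by blast
  next
    have half: "g ` X \<subseteq> I \<or> g ` X \<inter> I = {}" if "X \<subseteq> {0..1} - {\<tau>}" "connected X" for X
    proof (rule same)
      show "connected (g ` X)"
        using that by (intro connected_continuous_image continuous_on_subset[OF contg]) auto
      show "g ` X \<inter> J = {}"
      proof (rule ccontr)
        assume "g ` X \<inter> J \<noteq> {}"
        then obtain t where t: "t \<in> X" "g t \<in> J" by blast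
        then have "t \<in> {0..1}" "t \<noteq> \<tau>" using that(1) by auto
        then have "g t \<noteq> p" "g t \<in> path_image g" using simple[OF g] unfolding p_def path_image_def by auto
        then show False using t(2) J(2) g unfolding W_def by blast
      qed
    qed
    have "isCont g \<tau>" using deriv has_vector_derivative_continuous by blast
    then obtain \<delta> where \<delta>: "0 < \<delta>" "\<And>t. dist t \<tau> < \<delta> \<Longrightarrow> g t \<in> ball p \<eta>"
      unfolding continuous_at_eps_delta p_def using J(3) by (metis mem_ball dist_commute)
    define s where "s = min \<delta> \<epsilon> / 2"
    have s: "0 < s" "s < \<delta>" "s < \<epsilon>" using \<delta>(1) \<epsilon>(1) by (auto simp: s_def)
    have b: "g (\<tau> + s) \<in> ball p \<eta>" "g (\<tau> - s) \<in> ball p \<eta>"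
      using s \<delta>(2)[of "\<tau> + s"] \<delta>(2)[of "\<tau> - s"] by (simp_all add: dist_real_def)
    have "0 < (g (\<tau> + s) - p) \<bullet> v" "(g (\<tau> - s) - p) \<bullet> v < 0"
      using pos[of "\<tau> + s"] neg[of "\<tau> - s"] s by (auto simp: \<phi>_def)
    then have "g (\<tau> + s) \<in> I \<longleftrightarrow> g (\<tau> - s) \<notin> I" using sides b by blast
    moreover have "g (\<tau> + s) \<in> I \<longleftrightarrow> g 1 \<in> I"
    proof -
      have "{\<tau> + s..1} \<subseteq> {0..1} - {\<tau>}" using s \<tau> by auto
      then have "g ` {\<tau> + s..1} \<subseteq> I \<or> g ` {\<tau> + s..1} \<inter> I = {}" by (rule half) simp
      moreover have "g (\<tau> + s) \<in> g ` {\<tau> + s..1}" "g 1 \<in> g ` {\<tau> + s..1}" using s \<epsilon> by auto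
      ultimately show ?thesis by blast
    qed
    moreover have "g (\<tau> - s) \<in> I \<longleftrightarrow> g 0 \<in> I"
    proof -
      have "{0..\<tau> - s} \<subseteq> {0..1} - {\<tau>}" using s \<tau> by auto
      then have "g ` {0..\<tau> - s} \<subseteq> I \<or> g ` {0..\<tau> - s} \<inter> I = {}" by (rule half) simp
      moreover have "g (\<tau> - s) \<in> g ` {0..\<tau> - s}" "g 0 \<in> g ` {0..\<tau> - s}" using s \<epsilon> by auto
      ultimately show ?thesis by blast
    qed
    ultimately show "g 0 \<in> I \<longleftrightarrow> g 1 \<notin> I" by blast
  next
    fix C assume C: "C \<in> components (- \<Omega>)" "C \<inter> I \<noteq> {}"
    have "C \<inter> J = {}" using in_components_subset[OF C(1)] \<open>J \<subseteq> \<Omega>\<close> by blast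
    then have "C \<subseteq> I" using same[OF in_components_connected[OF C(1)]] C(2) by blast
    then show "C \<subseteq> I \<and> bounded C" using I(2) bounded_subset by blast
  qed
qed

section \<open>Transversal paths in a region with smooth boundary\<close>

text \<open>
The points are relatively open singletons, and a second countable space has the Lindelof property.
\<close>

lemma countable_if_isolated:
  fixes S :: "'a::second_countable_topology set"
  assumes "\<And>x. x \<in> S \<Longrightarrow> \<exists>T. open T \<and> S \<inter> T = {x}"
  shows "countable S"
proof -
  have open_in_S: "openin (top_of_set S) {x}" if "x \<in> S" for x
    using assms[OF that] by (metis openin_open)
  obtain F where F: "F \<subseteq> (\<lambda>x. {x}) ` S" "countable F" "\<Union>F = \<Union>((\<lambda>x. {x}) ` S)"
    using Lindelof_openin[of "(\<lambda>x. {x}) ` S" S] open_in_S by auto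
  have "countable (\<Union>F)" using F by (intro countable_UN[of F id, simplified]) auto
  then show ?thesis using F(3) by simp
qed

text \<open>
An injective linear \<open>f'\<close> satisfies \<open>B * norm h \<le> norm (f' h)\<close> for some \<open>B > 0\<close>, which outweighs the
error of the linear approximation near \<open>x\<close>.
\<close>

lemma isolated_zero:
  fixes f :: "'a::euclidean_space \<Rightarrow> 'b::euclidean_space"
  assumes f: "(f has_derivative f') (at x)" "f x = 0" and inj: "\<And>h. f' h = 0 \<Longrightarrow> h = 0"
  obtains e where "0 < e" "\<And>y. dist y x < e \<Longrightarrow> f y = 0 \<Longrightarrow> y = x"
proof -
  have lin: "linear f'" using f has_derivative_linear by blast
  then have "inj f'" using inj linear_injective_0 by blast
  then obtain B where B: "B > 0" "\<And>h. B * norm h \<le> norm (f' h)"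
    using linear_inj_bounded_below_pos[OF lin] by blast
  have "0 < B / 2" using B(1) by simp
  then have "\<exists>e>0. \<forall>y. norm (y - x) < e \<longrightarrow> norm (f y - f x - f' (y - x)) \<le> B / 2 * norm (y - x)"
    using f(1) unfolding has_derivative_at_alt by blast
  then obtain e where e: "e > 0" "\<And>y. norm (y - x) < e \<Longrightarrow> norm (f y - f x - f' (y - x)) \<le> B / 2 * norm (y - x)"
    by blast
  show thesis
  proof (rule that[OF e(1)])
    fix y assume "dist y x < e" "f y = 0"
    then have "norm (f' (y - x)) \<le> B / 2 * norm (y - x)"
      using e(2)[of y] f(2) by (simp add: dist_norm)
    then have "B * norm (y - x) \<le> B / 2 * norm (y - x)" by (rule order_trans[OF B(2)])
    then have "norm (y - x) \<le> 0" using B(1) by (simp add: mult_le_cancel_right)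
    then show "y = x" by simp
  qed
qed

lemma spanning_pair_independent:
  fixes v w :: "real ^ 2"
  assumes "span {v, w} = UNIV" "a *\<^sub>R v = b *\<^sub>R w"
  shows "a = 0 \<and> b = 0"
proof -
  have d: "dim (UNIV :: (real^2) set) = 2" by (simp add: dim_UNIV)
  have fin: "card {v, w} \<le> 2" by (simp add: card_insert_if)
  have ind: "independent {v, w}"
    by (rule card_le_dim_spanning[of _ UNIV]) (use assms(1) d fin in auto)
  have "v \<noteq> w"
  proof
    assume "v = w"
    then have "dim (span {v}) = 2" using assms(1) d by simp
    moreover have "dim (span {v}) \<le> card {v}" by (metis dim_span dim_le_card' finite.emptyI finite.insertI)
    ultimately show False by simp
  qed
  define u where "u = (\<lambda>x. if x = v then a else - b)"
  have "(\<Sum>x\<in>{v,w}. u x *\<^sub>R x) = 0"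
    using \<open>v \<noteq> w\<close> assms(2) by (simp add: u_def)
  then have "u v = 0" "u w = 0"
    using ind independentD[of "{v,w}" "{v,w}" u] by auto
  then show ?thesis using \<open>v \<noteq> w\<close> by (simp add: u_def)
qed

lemma C_infinity_on_imp_has_vector_derivative:
  assumes "C_infinity_on S f" "t \<in> S"
  obtains v where "(f has_vector_derivative v) (at t within S)"
proof -
  obtain D where D: "\<And>t. t \<in> S \<Longrightarrow> D 0 t = f t"
    "\<And>n t. t \<in> S \<Longrightarrow> (D n has_vector_derivative D (Suc n) t) (at t within S)"
    using assms(1) unfolding C_infinity_on_def by blast
  have "(f has_vector_derivative D (Suc 0) t) (at t within S)"
    by (rule has_vector_derivative_transform[OF assms(2) _ D(2)[OF assms(2), of 0]]) (simp add: D(1))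
  then show thesis by (rule that)
qed

lemma piecewise_smooth_path_has_velocity:
  assumes "piecewise_smooth_path g"
  obtains P where "finite P" "{0, 1} \<subseteq> P" "P \<subseteq> {0..1}"
    "\<And>t. t \<in> {0..1} - P \<Longrightarrow> (g has_vector_derivative vector_derivative g (at t)) (at t)"
proof -
  obtain P where P: "finite P" "{0, 1} \<subseteq> P" "P \<subseteq> {0..1}"
    "\<forall>a\<in>P. \<forall>b\<in>P. a < b \<and> P \<inter> {a<..<b} = {} \<longrightarrow> C_infinity_on {a..b} g"
    using assms unfolding piecewise_smooth_path_def by blast
  have "(g has_vector_derivative vector_derivative g (at t)) (at t)" if t: "t \<in> {0..1} - P" for t
  proof -
    define a where "a = Max {p \<in> P. p < t}"
    define b where "b = Min {p \<in> P. t < p}"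
    have "0 \<in> {p \<in> P. p < t}" "1 \<in> {p \<in> P. t < p}" using t P(2) by (auto simp: order_less_le)
    then have ne: "{p \<in> P. p < t} \<noteq> {}" "{p \<in> P. t < p} \<noteq> {}" by blast+
    have fin: "finite {p \<in> P. p < t}" "finite {p \<in> P. t < p}" using P(1) by auto
    have a: "a \<in> P" "a < t" using Max_in[OF fin(1) ne(1)] by (auto simp: a_def)
    have b: "b \<in> P" "t < b" using Min_in[OF fin(2) ne(2)] by (auto simp: b_def)
    have "P \<inter> {a<..<b} = {}"
    proof (rule ccontr)
      assume "P \<inter> {a<..<b} \<noteq> {}"
      then obtain q where q: "q \<in> P" "a < q" "q < b" by auto
      have "q < t \<or> t < q" using t q(1) by (metis Diff_iff linorder_neqE)
      then show False
      proof
        assume "q < t"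
        then have "q \<le> a" unfolding a_def using fin(1) q(1) by (intro Max_ge) auto
        with q show False by simp
      next
        assume "t < q"
        then have "b \<le> q" unfolding b_def using fin(2) q(1) by (intro Min_le) auto
        with q show False by simp
      qed
    qed
    then have "C_infinity_on {a..b} g" using P(4) a b by auto
    then obtain v where "(g has_vector_derivative v) (at t within {a..b})"
      using C_infinity_on_imp_has_vector_derivative a b by (metis atLeastAtMost_iff less_imp_le)
    then have "(g has_vector_derivative v) (at t)"
      using at_within_Icc_at a(2) b(2) by metis
    then show ?thesis by (simp only: vector_derivative_at)
  qed
  then show thesis by (rule that[OF P(1-3)])
qed

lemma velocities_interior:
  assumes "(g has_vector_derivative v) (at t)" "0 < t" 
  shows "v \<in> velocities g t"
  using assms by (auto simp: velocities_def intro: has_vector_derivative_at_within)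

lemma negligible_path_image:
  fixes g :: "real \<Rightarrow> real ^ 2"
  assumes "piecewise_smooth_path g"
  shows "negligible (path_image g)"
proof -
  obtain P where P: "finite P" "{0, 1} \<subseteq> P" "P \<subseteq> {0..1}"
    "\<And>t. t \<in> {0..1} - P \<Longrightarrow> (g has_vector_derivative vector_derivative g (at t)) (at t)"
    using piecewise_smooth_path_has_velocity[OF assms] by metis
  have "g differentiable_on ({0..1} - P)"
    unfolding differentiable_on_def
    using P(4) by (metis differentiableI_vector differentiable_at_withinI)
  then have "negligible (g ` ({0..1} - P))"
    by (intro negligible_differentiable_image_lowdim) auto
  moreover have "negligible (g ` P)" using P(1) by (simp add: negligible_finite)
  moreover have "path_image g = g ` ({0..1} - P) \<union> g ` P"
    using P(3) by (auto simp: path_image_def)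
  ultimately show ?thesis by simp
qed

text \<open>
Removing fewer paths keeps the complement connected: the images of the paths are null sets, so that
the smaller complement is dense in the larger one. Countability of \<open>\<Gamma>\<close> enters here. The lemma
allows passing from an infinite family to a finite one, whose complement is open and hence path connected.
\<close>

lemma connected_minus_subfamily:
  fixes \<Omega> :: "(real ^ 2) set"
  assumes "open \<Omega>" "countable \<Gamma>" "\<And>g. g \<in> \<Gamma> \<Longrightarrow> piecewise_smooth_path g"
    and conn: "connected (\<Omega> - (\<Union>g\<in>\<Gamma>. path_image g))" and "\<Delta> \<subseteq> \<Gamma>"
  shows "connected (\<Omega> - (\<Union>g\<in>\<Delta>. path_image g))"
proof (rule connected_intermediate_closure[OF conn])
  let ?N = "\<Union>g\<in>\<Gamma>. path_image g"
  show "\<Omega> - ?N \<subseteq> \<Omega> - (\<Union>g\<in>\<Delta>. path_image g)" using \<open>\<Delta> \<subseteq> \<Gamma>\<close> by blast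
  have neg: "negligible ?N"
    using assms(2,3) by (intro negligible_countable_Union) (auto intro: negligible_path_image)
  show "\<Omega> - (\<Union>g\<in>\<Delta>. path_image g) \<subseteq> closure (\<Omega> - ?N)"
  proof
    fix x assume "x \<in> \<Omega> - (\<Union>g\<in>\<Delta>. path_image g)"
    then have x: "x \<in> \<Omega>" by simp
    show "x \<in> closure (\<Omega> - ?N)"
    proof (rule ccontr)
      assume "x \<notin> closure (\<Omega> - ?N)"
      then have "\<Omega> - closure (\<Omega> - ?N) \<noteq> {}" using x by blast
      moreover have "open (\<Omega> - closure (\<Omega> - ?N))" using \<open>open \<Omega>\<close> by auto
      moreover have "\<Omega> - closure (\<Omega> - ?N) \<subseteq> ?N"
        using closure_subset[of "\<Omega> - ?N"] by blast
      ultimately show False using neg negligible_subset open_not_negligible by blast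
    qed
  qed
qed

text \<open>
The definition describes \<open>\<Omega>\<close> in local coordinates; by continuity of \<open>f\<close> its frontier is contained in
the graph.
\<close>

lemma boundary_chart:
  fixes \<Omega> :: "(real ^ 2) set"
  assumes "open \<Omega>" "smooth_boundary \<Omega>" "p \<in> frontier \<Omega>"
  obtains r e n f where "r > 0" "norm e = 1" "norm n = 1" "e \<bullet> n = 0"
    "\<And>s. \<exists>m. (f has_real_derivative m) (at s)"
    "\<And>x. x \<in> ball p r \<Longrightarrow> x \<in> \<Omega> \<longleftrightarrow> f (x \<bullet> e) < x \<bullet> n"
    "\<And>x. x \<in> ball p r \<Longrightarrow> x \<in> frontier \<Omega> \<Longrightarrow> x \<bullet> n = f (x \<bullet> e)"
proof -
  obtain r e n f where r: "r > 0" and en: "norm e = 1" "norm n = 1" "e \<bullet> n = 0"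
    and f: "C_infinity_on UNIV f" and graph: "\<Omega> \<inter> ball p r = {x \<in> ball p r. f (x \<bullet> e) < x \<bullet> n}"
    using assms(2,3) unfolding smooth_boundary_def by blast
  then have graph: "x \<in> \<Omega> \<longleftrightarrow> f (x \<bullet> e) < x \<bullet> n" if "x \<in> ball p r" for x
    using that by blast
  have df: "\<exists>m. (f has_real_derivative m) (at s)" for s
    by (rule C_infinity_on_imp_has_vector_derivative[OF f, of s])
      (auto simp: has_real_derivative_iff_has_vector_derivative)
  have contf: "continuous_on UNIV f"
    using df DERIV_isCont by (fastforce intro: continuous_at_imp_continuous_on)
  have fr: "x \<bullet> n = f (x \<bullet> e)" if x: "x \<in> frontier \<Omega>" "x \<in> ball p r" for x
  proof (rule antisym)
    have "x \<notin> \<Omega>" using x(1) \<open>open \<Omega>\<close> by (auto simp: frontier_def interior_open)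
    then show "x \<bullet> n \<le> f (x \<bullet> e)" using graph[OF x(2)] by simp
    show "f (x \<bullet> e) \<le> x \<bullet> n"
    proof (rule ccontr)
      assume "\<not> f (x \<bullet> e) \<le> x \<bullet> n"
      then have "x \<in> ball p r \<inter> {y. y \<bullet> n < f (y \<bullet> e)}" using x by auto
      moreover have "open (ball p r \<inter> {y. y \<bullet> n < f (y \<bullet> e)})"
        by (intro open_Int open_ball open_Collect_less continuous_on_compose2[OF contf] continuous_intros) auto
      moreover have "\<Omega> \<inter> (ball p r \<inter> {y. y \<bullet> n < f (y \<bullet> e)}) = {}" using graph by fastforce
      ultimately have "x \<notin> closure \<Omega>" unfolding closure_iff_nhds_not_empty by blast
      then show False using x(1) by (simp add: frontier_def)
    qed
  qed
  show thesis
    by (rule that[OF r en df graph fr])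
qed

text \<open>
A curve in the frontier satisfies \<open>y = f x\<close> in local coordinates, hence its velocity is on the tangent
line of the graph, whose normal is \<open>w\<close>.
\<close>

lemma tangent_vectors_in_line:
  fixes \<Omega> :: "(real ^ 2) set"
  assumes "open \<Omega>" "smooth_boundary \<Omega>" "p \<in> frontier \<Omega>"
  obtains w where "w \<noteq> 0" "\<And>v. v \<in> tangent_vectors (frontier \<Omega>) p \<Longrightarrow> w \<bullet> v = 0"
proof -
  obtain r e n f where r: "r > 0" and en: "norm e = 1" "norm n = 1" "e \<bullet> n = 0"
    and df: "\<And>s. \<exists>m. (f has_real_derivative m) (at s)"
    and fr: "\<And>x. x \<in> ball p r \<Longrightarrow> x \<in> frontier \<Omega> \<Longrightarrow> x \<bullet> n = f (x \<bullet> e)"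
    using boundary_chart[OF assms] by metis
  obtain m where m: "(f has_real_derivative m) (at (p \<bullet> e))" using df by blast
  show thesis
  proof (rule that[of "n - m *\<^sub>R e"])
    have "(n - m *\<^sub>R e) \<bullet> n = 1" using en by (simp add: inner_diff_left norm_eq_1)
    then show "n - m *\<^sub>R e \<noteq> 0" by auto
    fix v assume "v \<in> tangent_vectors (frontier \<Omega>) p"
    then obtain c where c: "range c \<subseteq> frontier \<Omega>" "c 0 = p" "(c has_vector_derivative v) (at 0)"
      unfolding tangent_vectors_def by blast
    have d1: "((\<lambda>t. c t \<bullet> n) has_real_derivative v \<bullet> n) (at 0)"
      and d2: "((\<lambda>t. c t \<bullet> e) has_real_derivative v \<bullet> e) (at 0)"
      unfolding has_real_derivative_iff_has_vector_derivative
      by (rule bounded_linear.has_vector_derivative[OF bounded_linear_inner_left c(3)])+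
    have d3: "((\<lambda>t. f (c t \<bullet> e)) has_real_derivative m * (v \<bullet> e)) (at 0)"
      by (rule DERIV_chain2[of f m "\<lambda>t. c t \<bullet> e" 0]) (use m c(2) d2 in auto)
    have "isCont c 0" using c(3) has_vector_derivative_continuous by blast
    then have "(c \<longlongrightarrow> p) (nhds 0)"
      using c(2) tendsto_at_iff_tendsto_nhds[of c 0] by (simp add: isCont_def)
    then have "\<forall>\<^sub>F t in nhds 0. c t \<in> ball p r"
      by (rule topological_tendstoD) (use r in auto)
    then have "\<forall>\<^sub>F t in nhds 0. c t \<bullet> n = f (c t \<bullet> e)"
      by (rule eventually_mono) (use fr c(1) in blast)
    then have "((\<lambda>t. f (c t \<bullet> e)) has_real_derivative v \<bullet> n) (at 0)"
      by (rule DERIV_cong_ev[OF refl _ refl, THEN iffD1, OF _ d1])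
    then have "v \<bullet> n = m * (v \<bullet> e)" using d3 DERIV_unique by blast
    then show "(n - m *\<^sub>R e) \<bullet> v = 0" by (simp add: inner_diff_left inner_commute[of v])
  qed
qed

text \<open>
A path cannot run inside the boundary, where its velocity would be tangent to the boundary. So a
path in the closure that is transversal to the boundary visits the open region during any such interval.
\<close>

lemma not_within_boundary_on_interval:
  fixes \<Omega> :: "(real ^ 2) set"
  assumes "open \<Omega>" "smooth_boundary \<Omega>" "transversal_to_boundary \<Omega> g"
    and "open U" "U \<subseteq> {0<..<1}" "s \<in> U" "(g has_vector_derivative v) (at s)"
  shows "\<exists>t\<in>U. g t \<notin> frontier \<Omega>"
proof (rule ccontr)
  assume "\<not> (\<exists>t\<in>U. g t \<notin> frontier \<Omega>)"
  then have fr: "g t \<in> frontier \<Omega>" if "t \<in> U" for t using that by blast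
  obtain \<epsilon> where \<epsilon>: "0 < \<epsilon>" "ball s \<epsilon> \<subseteq> U" using assms(4,6) open_contains_ball by blast
  (* constant far from 0, since the curve must remain in the frontier for all times *)
  define c where "c t = (if t \<in> ball 0 \<epsilon> then g (s + t) else g s)" for t
  have "((\<lambda>t. g (s + t)) has_vector_derivative v) (at 0)"
    using vector_diff_chain_at[OF has_vector_derivative_add[OF has_vector_derivative_const has_vector_derivative_id],
        of g v s 0] assms(7) by (simp add: o_def)
  then have "(c has_vector_derivative v) (at 0)"
    by (rule has_vector_derivative_transform_within_open[of _ _ _ "ball 0 \<epsilon>"])
      (use \<epsilon> in \<open>auto simp: c_def\<close>)
  moreover have "range c \<subseteq> frontier \<Omega>"
    using \<epsilon> assms(6) by (auto simp: c_def dist_real_def intro!: fr)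
  moreover have "c 0 = g s" using \<epsilon> by (simp add: c_def)
  ultimately have v: "v \<in> tangent_vectors (frontier \<Omega>) (g s)"
    unfolding tangent_vectors_def by blast
  obtain w where w: "w \<noteq> 0" "\<And>v. v \<in> tangent_vectors (frontier \<Omega>) (g s) \<Longrightarrow> w \<bullet> v = 0"
    using tangent_vectors_in_line[OF assms(1,2) fr[OF assms(6)]] by blast
  have s01: "s \<in> {0..1}" "0 < s" using assms(5,6) by auto
  have "v \<in> velocities g s" using velocities_interior[OF assms(7) s01(2)] .
  then have "span (insert v (tangent_vectors (frontier \<Omega>) (g s))) = UNIV"
    using assms(3) s01(1) fr[OF assms(6)] unfolding transversal_to_boundary_def by blast
  moreover have "span (insert v (tangent_vectors (frontier \<Omega>) (g s))) \<subseteq> {x. w \<bullet> x = 0}"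
    using w(2) v by (intro span_minimal subspace_hyperplane) auto
  ultimately have "w \<bullet> w = 0" by blast
  then show False using w(1) by simp
qed

text \<open>
All but countably many of the times that \<open>g\<close> spends in \<open>\<Omega>\<close> will do. Let
\<open>G\<close> be the open set of smooth times of \<open>g\<close> spent in \<open>\<Omega>\<close>; it is nonempty by
\<open>not_within_boundary_on_interval\<close>. A crossing with \<open>h\<close> at a smooth time of \<open>h\<close> is a zero of
\<open>(s, t) \<mapsto> g s - h t\<close>; by transversality the derivative of this map is injective there, so the zero is
isolated, and isolated points are countable. The values of \<open>h\<close> at its finitely many break points are
visited by \<open>g\<close> at isolated times only, since \<open>g\<close> is immersed.
\<close>

lemma regular_point:
  fixes \<Omega> :: "(real ^ 2) set" and \<Delta> :: "(real \<Rightarrow> real ^ 2) set"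
  assumes "open \<Omega>" "smooth_boundary \<Omega>" "countable \<Delta>"
    and \<Delta>: "\<And>h. h \<in> \<Delta> \<Longrightarrow> smooth_path_in (closure \<Omega>) h"
      "\<And>h. h \<in> \<Delta> \<Longrightarrow> immersed h" "\<And>h. h \<in> \<Delta> \<Longrightarrow> transversal_to_boundary \<Omega> h"
    and trans: "internally_transversal \<Omega> \<Delta>" and g: "g \<in> \<Delta>"
  obtains \<tau> v where "0 < \<tau>" "\<tau> < 1" "g \<tau> \<in> \<Omega>" "(g has_vector_derivative v) (at \<tau>)" "v \<noteq> 0"
    "\<And>h t. h \<in> \<Delta> \<Longrightarrow> t \<in> {0..1} \<Longrightarrow> h t = g \<tau> \<Longrightarrow> h = g \<and> t = \<tau>"
proof -
  define V :: "(real \<Rightarrow> real ^ 2) \<Rightarrow> real \<Rightarrow> real ^ 2" where "V h t = vector_derivative h (at t)" for h t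
  have "\<exists>P. finite P \<and> {0, 1} \<subseteq> P \<and> (\<forall>t\<in>{0..1} - P. (h has_vector_derivative V h t) (at t))"
    if "h \<in> \<Delta>" for h
  proof -
    have "piecewise_smooth_path h" using \<Delta>(1)[OF that] by (simp add: smooth_path_in_def)
    then show ?thesis unfolding V_def using piecewise_smooth_path_has_velocity by metis
  qed
  then obtain P where P: "\<And>h. h \<in> \<Delta> \<Longrightarrow> finite (P h)" "\<And>h. h \<in> \<Delta> \<Longrightarrow> {0, 1} \<subseteq> P h"
    and der: "\<And>h t. h \<in> \<Delta> \<Longrightarrow> t \<in> {0..1} - P h \<Longrightarrow> (h has_vector_derivative V h t) (at t)"
    by metis
  have vel: "V h t \<in> velocities h t" if "h \<in> \<Delta>" "t \<in> {0..1} - P h" for h t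
    using der[OF that] P(2)[OF that(1)] that(2) by (intro velocities_interior) (auto simp: order_less_le)
  have nz: "V h t \<noteq> 0" if "h \<in> \<Delta>" "t \<in> {0..1} - P h" for h t
    using vel[OF that] \<Delta>(2)[OF that(1)] that(2) unfolding immersed_def by force
  define U where "U = {0<..<1} - P g"
  have Usub: "U \<subseteq> {0..1} - P g" by (auto simp: U_def)
  have "open U" unfolding U_def using P(1)[OF g] by (intro open_Diff finite_imp_closed) auto
  define G where "G = U \<inter> g -` \<Omega>"
  have "continuous_on U g"
    using der[OF g] Usub by (meson continuous_at_imp_continuous_on has_vector_derivative_continuous subsetD)
  then have "open G" unfolding G_def using \<open>open U\<close> \<open>open \<Omega>\<close> continuous_open_preimage by blast
  have "G \<noteq> {}"
  proof -
    have "infinite U" unfolding U_def using P(1)[OF g] by (simp add: infinite_Ioo)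
    then have "U \<noteq> {}" by force
    then obtain s where s: "s \<in> U" by blast
    have "\<exists>t\<in>U. g t \<notin> frontier \<Omega>"
      by (rule not_within_boundary_on_interval[OF assms(1,2) \<Delta>(3)[OF g] \<open>open U\<close> _ s der[OF g]])
        (use s Usub in \<open>auto simp: U_def\<close>)
    then obtain t where t: "t \<in> U" "g t \<notin> frontier \<Omega>" by blast
    have "g t \<in> closure \<Omega>"
      using \<Delta>(1)[OF g] t(1) Usub unfolding smooth_path_in_def path_image_def by auto
    then have "g t \<in> \<Omega>" using t(2) \<open>open \<Omega>\<close> by (simp add: frontier_def interior_open)
    then show ?thesis using t(1) unfolding G_def by blast
  qed
  have dg: "(g has_derivative (\<lambda>x. x *\<^sub>R V g s)) (at s)" if "s \<in> G" for s
    using der[OF g] that Usub unfolding G_def has_vector_derivative_def by blast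
  have Gnz: "V g s \<noteq> 0" if "s \<in> G" for s using nz[OF g] that Usub unfolding G_def by blast
  have fibre: "countable {s \<in> G. g s = q}" for q
  proof (rule countable_if_isolated)
    fix s assume s: "s \<in> {s \<in> G. g s = q}"
    have "((\<lambda>x. g x - q) has_derivative (\<lambda>x. x *\<^sub>R V g s - 0)) (at s)"
      using dg s by (intro has_derivative_diff has_derivative_const) blast
    then obtain e where e: "0 < e" "\<And>y. dist y s < e \<Longrightarrow> g y - q = 0 \<Longrightarrow> y = s"
      by (rule isolated_zero) (use s Gnz in auto)
    have "{s \<in> G. g s = q} \<inter> ball s e = {s}" using s e by (auto simp: dist_commute)
    then show "\<exists>T. open T \<and> {s \<in> G. g s = q} \<inter> T = {s}" by blast
  qed
  define Z where "Z h = {(s, t). s \<in> G \<and> t \<in> {0..1} - P h \<and> (g, s) \<noteq> (h, t) \<and> g s = h t}" for h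
  have Zc: "countable (Z h)" if h: "h \<in> \<Delta>" for h
  proof (rule countable_if_isolated)
    fix z assume "z \<in> Z h"
    then obtain s t where z: "z = (s, t)" and st: "s \<in> G" "t \<in> {0..1} - P h" "(g, s) \<noteq> (h, t)" "g s = h t"
      unfolding Z_def by blast
    have sU: "s \<in> {0..1} - P g" using st(1) Usub unfolding G_def by blast
    have "g s \<in> \<Omega>" using st(1) unfolding G_def by blast
    then have sp: "span {V g s, V h t} = UNIV"
      using trans g h st sU vel[OF g sU] vel[OF h st(2)] unfolding internally_transversal_def by blast
    have d1: "((\<lambda>x. g (fst x)) has_derivative (\<lambda>x. fst x *\<^sub>R V g s)) (at z)"
      by (rule has_derivative_compose[OF has_derivative_fst[OF has_derivative_ident]])
        (use dg[OF st(1)] z in simp)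
    have d2: "((\<lambda>x. h (snd x)) has_derivative (\<lambda>x. snd x *\<^sub>R V h t)) (at z)"
      by (rule has_derivative_compose[OF has_derivative_snd[OF has_derivative_ident]])
        (use der[OF h st(2)] z in \<open>simp add: has_vector_derivative_def\<close>)
    have "((\<lambda>x. g (fst x) - h (snd x)) has_derivative (\<lambda>x. fst x *\<^sub>R V g s - snd x *\<^sub>R V h t)) (at z)"
      by (rule has_derivative_diff[OF d1 d2])
    moreover have "g (fst z) - h (snd z) = 0" using z st(4) by simp
    moreover have "x = 0" if "fst x *\<^sub>R V g s - snd x *\<^sub>R V h t = 0" for x :: "real \<times> real"
      using spanning_pair_independent[OF sp, of "fst x" "snd x"] that by (simp add: prod_eq_iff)
    ultimately obtain e where e: "0 < e" "\<And>y. dist y z < e \<Longrightarrow> g (fst y) - h (snd y) = 0 \<Longrightarrow> y = z"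
      by (rule isolated_zero) blast+
    have "Z h \<inter> ball z e = {z}"
    proof
      show "Z h \<inter> ball z e \<subseteq> {z}" using e(2) by (auto simp: Z_def dist_commute)
      show "{z} \<subseteq> Z h \<inter> ball z e" using e(1) \<open>z \<in> Z h\<close> by simp
    qed
    then show "\<exists>T. open T \<and> Z h \<inter> T = {z}" by blast
  qed
  define B where "B = (\<Union>h\<in>\<Delta>. (\<Union>q\<in>h ` P h. {s \<in> G. g s = q}) \<union> fst ` Z h)"
  have "countable B"
    unfolding B_def using Zc fibre P(1) \<open>countable \<Delta>\<close>
    by (intro countable_UN countable_Un countable_image) (auto intro: countable_finite)
  moreover have "uncountable G"
  proof -
    obtain s e where "0 < e" "ball s e \<subseteq> G" using \<open>open G\<close> \<open>G \<noteq> {}\<close> open_contains_ball by blast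
    then show ?thesis using uncountable_ball[of e s] countable_subset by blast
  qed
  ultimately have "\<not> G \<subseteq> B" using countable_subset by blast
  then obtain \<tau> where \<tau>: "\<tau> \<in> G" "\<tau> \<notin> B" by blast
  have \<tau>U: "\<tau> \<in> U" using \<tau>(1) unfolding G_def by blast
  show thesis
  proof (rule that)
    show "0 < \<tau>" "\<tau> < 1" using \<tau>U by (auto simp: U_def)
    show "g \<tau> \<in> \<Omega>" using \<tau>(1) by (simp add: G_def)
    show "(g has_vector_derivative V g \<tau>) (at \<tau>)" using der[OF g] \<tau>U Usub by blast
    show "V g \<tau> \<noteq> 0" using Gnz \<tau>(1) by blast
    fix h t assume ht: "h \<in> \<Delta>" "t \<in> {0..1}" "h t = g \<tau>"
    have "t \<notin> P h"
    proof
      assume "t \<in> P h"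
      then have "h t \<in> h ` P h" by blast
      moreover have "\<tau> \<in> {s \<in> G. g s = h t}" using \<tau>(1) ht(3) by simp
      ultimately have "\<tau> \<in> B" unfolding B_def using ht(1) by blast
      then show False using \<tau>(2) by blast
    qed
    show "h = g \<and> t = \<tau>"
    proof (rule ccontr)
      assume "\<not> (h = g \<and> t = \<tau>)"
      then have "(\<tau>, t) \<in> Z h" using \<tau>(1) ht \<open>t \<notin> P h\<close> unfolding Z_def by auto
      then have "\<tau> \<in> fst ` Z h" by force
      then have "\<tau> \<in> B" unfolding B_def using ht(1) by blast
      then show False using \<tau>(2) by blast
    qed
  qed
qed

section \<open>Finitely many holes\<close>

text \<open>
In the plane, three nonzero vectors cannot be pairwise orthogonal.
\<close>

lemma orthonormal_pair_expansion:
  fixes e n x :: "real ^ 2"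
  assumes "norm e = 1" "norm n = 1" "e \<bullet> n = 0"
  shows "x = (x \<bullet> e) *\<^sub>R e + (x \<bullet> n) *\<^sub>R n"
proof (rule ccontr)
  define z where "z = x - (x \<bullet> e) *\<^sub>R e - (x \<bullet> n) *\<^sub>R n"
  assume "\<not> ?thesis"
  then have "z \<noteq> 0" by (simp add: z_def algebra_simps)
  have ee: "e \<bullet> e = 1" "n \<bullet> n = 1" using assms(1,2) by (simp_all add: norm_eq_1)
  have ze: "z \<bullet> e = 0" "z \<bullet> n = 0"
    using assms(3) ee by (simp_all add: z_def inner_diff_left inner_commute[of n e])
  have dist: "z \<noteq> e" "z \<noteq> n" "e \<noteq> n" using ze assms(3) ee by auto
  have "pairwise orthogonal {z, e, n}"
    using ze assms(3) by (auto simp: pairwise_def orthogonal_def inner_commute)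
  moreover have "0 \<notin> {z, e, n}" using \<open>z \<noteq> 0\<close> ee by auto
  ultimately have "independent {z, e, n}" by (rule pairwise_orthogonal_independent)
  then have "card {z, e, n} \<le> DIM(real ^ 2)" using independent_bound by blast
  then show False using dist by simp
qed

text \<open>
In local coordinates the complement is the part of the plane below the graph. The image \<open>S\<close> of a
rectangle under \<open>(a, u) \<mapsto> (a, f a - u)\<close> is connected and contains all points of the complement near \<open>p\<close>.
\<close>

lemma complement_connected_near_boundary:
  fixes \<Omega> :: "(real ^ 2) set"
  assumes "open \<Omega>" "smooth_boundary \<Omega>" "p \<in> frontier \<Omega>"
  shows "\<exists>U S. open U \<and> p \<in> U \<and> connected S \<and> S \<subseteq> - \<Omega> \<and> U - \<Omega> \<subseteq> S"
proof -
  obtain r e n f where r: "r > 0" and en: "norm e = 1" "norm n = 1" "e \<bullet> n = 0"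
    and df: "\<And>s. \<exists>m. (f has_real_derivative m) (at s)"
    and graph: "\<And>x. x \<in> ball p r \<Longrightarrow> x \<in> \<Omega> \<longleftrightarrow> f (x \<bullet> e) < x \<bullet> n"
    and fr: "\<And>x. x \<in> ball p r \<Longrightarrow> x \<in> frontier \<Omega> \<Longrightarrow> x \<bullet> n = f (x \<bullet> e)"
    using boundary_chart[OF assms] by metis
  have contf: "isCont f s" for s using df DERIV_isCont by blast
  define s where "s = p \<bullet> e"
  have pn: "p \<bullet> n = f s" using fr[OF _ assms(3)] r by (simp add: s_def)
  have "0 < r / 8" using r by simp
  then obtain \<delta>0 where \<delta>0: "0 < \<delta>0" "\<And>a. \<bar>a - s\<bar> < \<delta>0 \<Longrightarrow> \<bar>f a - f s\<bar> < r / 8"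
    using contf[of s] unfolding continuous_at_eps_delta dist_real_def by blast
  define \<delta> where "\<delta> = min \<delta>0 (r / 8)"
  have \<delta>: "0 < \<delta>" "\<delta> \<le> r / 8" "\<And>a. \<bar>a - s\<bar> < \<delta> \<Longrightarrow> \<bar>f a - f s\<bar> < r / 8"
    using \<delta>0 r by (auto simp: \<delta>_def)
  define \<Psi> where "\<Psi> = (\<lambda>z. fst z *\<^sub>R e + (f (fst z) - snd z) *\<^sub>R n)"
  define Q where "Q = {s - \<delta><..<s + \<delta>} \<times> {0..<r / 4}"
  have coords: "\<Psi> z \<bullet> e = fst z" "\<Psi> z \<bullet> n = f (fst z) - snd z" for z
    using en by (simp_all add: \<Psi>_def inner_add_left norm_eq_1 inner_commute[of n e])
  have "connected (\<Psi> ` Q)"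
  proof (rule connected_continuous_image)
    have "continuous_on UNIV f" using contf by (simp add: continuous_at_imp_continuous_on)
    then have "continuous_on Q (\<lambda>z. f (fst z))"
      by (rule continuous_on_compose2) (auto intro: continuous_intros)
    then show "continuous_on Q \<Psi>" unfolding \<Psi>_def by (intro continuous_intros)
    show "connected Q" unfolding Q_def by (intro convex_connected convex_Times) auto
  qed
  moreover have "\<Psi> ` Q \<subseteq> - \<Omega>"
  proof clarify
    fix a u assume z: "(a, u) \<in> Q" "\<Psi> (a, u) \<in> \<Omega>"
    have "p = s *\<^sub>R e + f s *\<^sub>R n" using orthonormal_pair_expansion[OF en, of p] by (simp add: s_def pn)
    then have "\<Psi> (a, u) - p = (a - s) *\<^sub>R e + (f a - u - f s) *\<^sub>R n" by (simp add: \<Psi>_def algebra_simps)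
    then have "norm (\<Psi> (a, u) - p) \<le> \<bar>a - s\<bar> + \<bar>f a - u - f s\<bar>"
      using norm_triangle_ineq[of "(a - s) *\<^sub>R e" "(f a - u - f s) *\<^sub>R n"] en by simp
    moreover have "\<bar>a - s\<bar> < \<delta>" "0 \<le> u" "u < r / 4" using z(1) by (auto simp: Q_def)
    ultimately have "norm (\<Psi> (a, u) - p) < r" using \<delta>(2) \<delta>(3)[of a] by linarith
    then have "\<Psi> (a, u) \<in> ball p r" by (simp add: dist_norm norm_minus_commute)
    then have "f a < f a - u" using graph z(2) coords[of "(a, u)"] by simp
    then show False using \<open>0 \<le> u\<close> by simp
  qed
  moreover have "ball p \<delta> - \<Omega> \<subseteq> \<Psi> ` Q"
  proof
    fix x assume x: "x \<in> ball p \<delta> - \<Omega>"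
    have d: "norm (x - p) < \<delta>" using x by (simp add: dist_norm norm_minus_commute)
    have "\<bar>(x - p) \<bullet> e\<bar> \<le> norm (x - p)" "\<bar>(x - p) \<bullet> n\<bar> \<le> norm (x - p)"
      using Cauchy_Schwarz_ineq2[of "x - p" e] Cauchy_Schwarz_ineq2[of "x - p" n] en by simp_all
    then have xe: "\<bar>x \<bullet> e - s\<bar> < \<delta>" and xn: "\<bar>x \<bullet> n - f s\<bar> < \<delta>"
      using d by (simp_all add: inner_diff_left s_def pn)
    have "x \<in> ball p r" using d \<delta>(2) r by (simp add: dist_norm norm_minus_commute)
    then have "x \<bullet> n \<le> f (x \<bullet> e)" using graph x by force
    moreover have "f (x \<bullet> e) - x \<bullet> n < r / 4" using xn \<delta>(2) \<delta>(3)[OF xe] by linarith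
    ultimately have "(x \<bullet> e, f (x \<bullet> e) - x \<bullet> n) \<in> Q"
      using xe by (auto simp: Q_def abs_less_iff)
    moreover have "x = \<Psi> (x \<bullet> e, f (x \<bullet> e) - x \<bullet> n)"
      using orthonormal_pair_expansion[OF en, of x] by (simp add: \<Psi>_def)
    ultimately show "x \<in> \<Psi> ` Q" by blast
  qed
  ultimately show ?thesis using \<delta>(1) by (intro exI[of _ "ball p \<delta>"] exI[of _ "\<Psi> ` Q"]) auto
qed

text \<open>
This translates between a boundary component, the frontier of a component \<open>C\<close> of \<open>- \<Omega>\<close>, and \<open>C\<close> itself,
which is easier to handle because components are connected and disjoint.
\<close>

lemma frontier_in_component:
  fixes \<Omega> :: "'a::euclidean_space set"
  assumes "open \<Omega>" "C \<in> components (- \<Omega>)" "p \<in> frontier \<Omega>"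
  shows "p \<in> frontier C \<longleftrightarrow> p \<in> C"
proof
  have "closed C" using assms(1,2) closed_components by (metis closed_Compl)
  then show "p \<in> frontier C \<Longrightarrow> p \<in> C" using frontier_subset_closed by blast
  assume "p \<in> C"
  have "p \<notin> interior C"
  proof
    assume "p \<in> interior C"
    moreover have "interior C \<inter> \<Omega> = {}" using interior_subset in_components_subset[OF assms(2)] by blast
    then have "interior C \<inter> closure \<Omega> = {}" by (simp add: open_Int_closure_eq_empty)
    ultimately show False using assms(3) by (auto simp: frontier_def)
  qed
  then show "p \<in> frontier C" using \<open>p \<in> C\<close> closure_subset by (auto simp: frontier_def)
qed

text \<open>
A component without points of the frontier would be open and closed.
\<close>

lemma component_meets_frontier:
  fixes \<Omega> :: "'a::euclidean_space set"
  assumes "open \<Omega>" "\<Omega> \<noteq> {}" "C \<in> components (- \<Omega>)"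
  shows "C \<inter> frontier \<Omega> \<noteq> {}"
proof
  assume empty: "C \<inter> frontier \<Omega> = {}"
  have CO: "C \<subseteq> - \<Omega>" using in_components_subset[OF assms(3)] .
  have "open C"
    unfolding open_contains_ball
  proof
    fix x assume "x \<in> C"
    then have "x \<notin> closure \<Omega>" using empty CO assms(1) by (auto simp: frontier_def interior_open)
    then obtain \<epsilon> where \<epsilon>: "0 < \<epsilon>" "ball x \<epsilon> \<subseteq> - closure \<Omega>"
      using open_contains_ball[of "- closure \<Omega>"] by auto
    have "ball x \<epsilon> \<subseteq> C"
    proof (rule components_maximal[OF assms(3)])
      show "ball x \<epsilon> \<subseteq> - \<Omega>" using \<epsilon>(2) closure_subset by blast
      show "C \<inter> ball x \<epsilon> \<noteq> {}" using \<open>x \<in> C\<close> \<epsilon>(1) by (auto intro!: exI[of _ x])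
    qed simp
    then show "\<exists>e>0. ball x e \<subseteq> C" using \<epsilon>(1) by blast
  qed
  moreover have "closed C" using assms(1,3) closed_components by (metis closed_Compl)
  ultimately have "C = {} \<or> C = UNIV" using clopen by blast
  then show False using in_components_nonempty[OF assms(3)] CO assms(2) by blast
qed

text \<open>
Near each point of the compact frontier there is only one component of the complement, and every
component comes to the frontier somewhere. Finiteness of the set of holes lets the parities at
the single holes be added up.
\<close>

lemma finite_components_complement:
  fixes \<Omega> :: "(real ^ 2) set"
  assumes "open \<Omega>" "bounded \<Omega>" "\<Omega> \<noteq> {}" "smooth_boundary \<Omega>"
  shows "finite (components (- \<Omega>))"
proof -
  obtain U S where US: "\<And>p. p \<in> frontier \<Omega> \<Longrightarrow> open (U p)" "\<And>p. p \<in> frontier \<Omega> \<Longrightarrow> p \<in> U p"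
    "\<And>p. p \<in> frontier \<Omega> \<Longrightarrow> connected (S p)" "\<And>p. p \<in> frontier \<Omega> \<Longrightarrow> S p \<subseteq> - \<Omega>"
    "\<And>p. p \<in> frontier \<Omega> \<Longrightarrow> U p - \<Omega> \<subseteq> S p"
    using complement_connected_near_boundary[OF assms(1,4)] by metis
  have "compact (frontier \<Omega>)" using assms(2) by (simp add: compact_frontier_bounded)
  then obtain F where F: "F \<subseteq> frontier \<Omega>" "finite F" "frontier \<Omega> \<subseteq> (\<Union>p\<in>F. U p)"
    by (rule compactE_image[of "frontier \<Omega>" "frontier \<Omega>" U]) (use US(1,2) in auto)
  have "finite {C \<in> components (- \<Omega>). C \<inter> S p \<noteq> {}}" (is "finite ?A") if "p \<in> F" for p
  proof -
    have p: "p \<in> frontier \<Omega>" using that F(1) by blast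
    have "C = C'" if "C \<in> components (- \<Omega>)" "C \<inter> S p \<noteq> {}" "C' \<in> components (- \<Omega>)" "C' \<inter> S p \<noteq> {}" for C C'
    proof -
      have "S p \<subseteq> C" "S p \<subseteq> C'"
        using components_maximal[OF that(1) US(3,4)[OF p] that(2)]
          components_maximal[OF that(3) US(3,4)[OF p] that(4)] by auto
      then have "C \<inter> C' \<noteq> {}" using that(2) by blast
      then show ?thesis using components_nonoverlap[OF that(1,3)] by blast
    qed
    then have one: "?A \<subseteq> {C}" if "C \<in> ?A" for C using that by blast
    show "finite ?A"
    proof (cases "?A = {}")
      case False
      then obtain C where "C \<in> ?A" by blast
      then show ?thesis using finite_subset[OF one] by blast
    qed (simp only: finite.emptyI)
  qed
  then have "finite (\<Union>p\<in>F. {C \<in> components (- \<Omega>). C \<inter> S p \<noteq> {}})" using F(2) by blast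
  moreover have "components (- \<Omega>) \<subseteq> (\<Union>p\<in>F. {C \<in> components (- \<Omega>). C \<inter> S p \<noteq> {}})"
  proof
    fix C assume C: "C \<in> components (- \<Omega>)"
    obtain q where q: "q \<in> C" "q \<in> frontier \<Omega>" using component_meets_frontier[OF assms(1,3) C] by blast
    then obtain p where p: "p \<in> F" "q \<in> U p" using F(3) by blast
    have "q \<notin> \<Omega>" using q(1) in_components_subset[OF C] by blast
    then have "q \<in> S p" using US(5) p F(1) by blast
    then show "C \<in> (\<Union>p\<in>F. {C \<in> components (- \<Omega>). C \<inter> S p \<noteq> {}})" using C q(1) p(1) by blast
  qed
  ultimately show ?thesis by (rule rev_finite_subset)
qed

section \<open>Counting ends modulo 2\<close>

text \<open>
This is the graph-theoretic core: contract each component of \<open>- \<Omega>\<close> to a point, so that the paths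
become edges. If a nonempty finite family had an even number of ends at each hole, it would be a
cycle modulo 2, and a cycle would cut \<open>\<Omega>\<close>. Concretely, count the ends in the domain \<open>I\<close> from
\<open>separating_domain\<close> in two ways: path by path the number is odd, as only \<open>g\<close> contributes an odd
number; component by component it is even, as all the components that lie in \<open>I\<close> are bounded, that is,
holes. The unbounded component does not occur.
\<close>

lemma slits_subfamily_odd_at_some_hole:
  fixes \<Omega> :: "(real ^ 2) set" and \<Gamma> \<Delta> :: "(real \<Rightarrow> real ^ 2) set"
  assumes "open \<Omega>" "bounded \<Omega>" "smooth_boundary \<Omega>" "slits \<Gamma> \<Omega>"
    and "\<Delta> \<subseteq> \<Gamma>" "finite \<Delta>" "\<Delta> \<noteq> {}"
  shows "\<exists>H\<in>holes \<Omega>. odd (\<Sum>h\<in>\<Delta>. of_bool (h 0 \<in> H) + of_bool (h 1 \<in> H) :: nat)"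
proof (rule ccontr)
  assume "\<not> ?thesis"
  then have even_hole: "even (\<Sum>h\<in>\<Delta>. of_bool (h 0 \<in> H) + of_bool (h 1 \<in> H) :: nat)" if "H \<in> holes \<Omega>" for H
    using that by blast
  obtain g where g: "g \<in> \<Delta>" using \<open>\<Delta> \<noteq> {}\<close> by blast
  have \<Gamma>: "countable \<Gamma>" "internally_transversal \<Omega> \<Gamma>" "connected (\<Omega> - (\<Union>g\<in>\<Gamma>. path_image g))"
    and line: "\<And>h. h \<in> \<Gamma> \<Longrightarrow> smooth_path_in (closure \<Omega>) h \<and> immersed h \<and>
            pathstart h \<in> frontier \<Omega> \<and> pathfinish h \<in> frontier \<Omega> \<and> transversal_to_boundary \<Omega> h"
    using \<open>slits \<Gamma> \<Omega>\<close> unfolding slits_def by blast+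
  have smooth: "smooth_path_in (closure \<Omega>) h" "immersed h" "transversal_to_boundary \<Omega> h"
    and ends: "h 0 \<in> frontier \<Omega>" "h 1 \<in> frontier \<Omega>" if "h \<in> \<Delta>" for h
    using line that \<open>\<Delta> \<subseteq> \<Gamma>\<close> unfolding pathstart_def pathfinish_def by blast+
  have pathD: "path h" if "h \<in> \<Delta>" for h
    using smooth(1)[OF that] by (simp add: smooth_path_in_def piecewise_smooth_path_def)
  have trans: "internally_transversal \<Omega> \<Delta>"
    using \<Gamma>(2) \<open>\<Delta> \<subseteq> \<Gamma>\<close> unfolding internally_transversal_def by blast
  have conn: "connected (\<Omega> - (\<Union>h\<in>\<Delta>. path_image h))"
    by (rule connected_minus_subfamily[OF \<open>open \<Omega>\<close> \<Gamma>(1) _ \<Gamma>(3) \<open>\<Delta> \<subseteq> \<Gamma>\<close>])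
      (use line in \<open>simp add: smooth_path_in_def\<close>)
  obtain \<tau> v where \<tau>: "0 < \<tau>" "\<tau> < 1" "g \<tau> \<in> \<Omega>" "(g has_vector_derivative v) (at \<tau>)" "v \<noteq> 0"
    "\<And>h t. h \<in> \<Delta> \<Longrightarrow> t \<in> {0..1} \<Longrightarrow> h t = g \<tau> \<Longrightarrow> h = g \<and> t = \<tau>"
    using regular_point[OF assms(1,3) countable_finite[OF \<open>finite \<Delta>\<close>] smooth trans g] by blast
  obtain I where other: "\<And>h. h \<in> \<Delta> \<Longrightarrow> h \<noteq> g \<Longrightarrow> h 0 \<in> I \<longleftrightarrow> h 1 \<in> I"
    and this_line: "g 0 \<in> I \<longleftrightarrow> g 1 \<notin> I"
    and comp: "\<And>C. C \<in> components (- \<Omega>) \<Longrightarrow> C \<inter> I \<noteq> {} \<Longrightarrow> C \<subseteq> I \<and> bounded C"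
    using separating_domain[OF \<open>open \<Omega>\<close> \<open>finite \<Delta>\<close> pathD conn g \<tau>] by blast
  (* the components of the complement that lie inside the Jordan curve *)
  define \<H> where "\<H> = {C \<in> components (- \<Omega>). C \<inter> I \<noteq> {}}"
  have "\<Omega> \<noteq> {}" using \<tau>(3) by blast
  then have fin: "finite \<H>"
    unfolding \<H>_def using finite_components_complement[OF assms(1,2) _ assms(3)] by simp
  have holes: "C \<in> holes \<Omega>" if "C \<in> \<H>" for C
    using that comp unfolding \<H>_def holes_def by blast
  have count: "(\<Sum>C\<in>\<H>. of_bool (x \<in> C)) = (of_bool (x \<in> I) :: nat)" if "x \<in> frontier \<Omega>" for x
  proof -
    have "x \<in> - \<Omega>" using that \<open>open \<Omega>\<close> by (auto simp: frontier_def interior_open)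
    then obtain C where C: "C \<in> components (- \<Omega>)" "x \<in> C" using Union_components[of "- \<Omega>"] by blast
    have uniq: "x \<in> C' \<longleftrightarrow> C' = C" if "C' \<in> \<H>" for C'
      using that C components_nonoverlap[of C' "- \<Omega>" C] unfolding \<H>_def by blast
    have "(\<Sum>C'\<in>\<H>. of_bool (x \<in> C')) = (\<Sum>C'\<in>\<H>. of_bool (C' = C) :: nat)"
      by (rule sum.cong) (simp_all only: uniq)
    also have "\<dots> = of_bool (C \<in> \<H>)" using fin by (simp add: of_bool_def)
    also have "C \<in> \<H> \<longleftrightarrow> x \<in> I" using C comp unfolding \<H>_def by blast
    finally show ?thesis .
  qed
  have "(\<Sum>C\<in>\<H>. \<Sum>h\<in>\<Delta>. of_bool (h 0 \<in> C) + of_bool (h 1 \<in> C) :: nat)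
      = (\<Sum>h\<in>\<Delta>. \<Sum>C\<in>\<H>. of_bool (h 0 \<in> C) + of_bool (h 1 \<in> C))"
    by (rule sum.swap)
  also have "\<dots> = (\<Sum>h\<in>\<Delta>. of_bool (h 0 \<in> I) + of_bool (h 1 \<in> I))"
    by (rule sum.cong) (use count ends in \<open>auto simp: sum.distrib\<close>)
  also have "\<dots> = of_bool (g 0 \<in> I) + of_bool (g 1 \<in> I) + (\<Sum>h\<in>\<Delta> - {g}. of_bool (h 0 \<in> I) + of_bool (h 1 \<in> I))"
    using \<open>finite \<Delta>\<close> g by (rule sum.remove)
  also have "(\<Sum>h\<in>\<Delta> - {g}. of_bool (h 0 \<in> I) + of_bool (h 1 \<in> I) :: nat) = (\<Sum>h\<in>\<Delta> - {g}. 2 * of_bool (h 0 \<in> I))"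
    by (rule sum.cong) (use other in auto)
  finally have "(\<Sum>C\<in>\<H>. \<Sum>h\<in>\<Delta>. of_bool (h 0 \<in> C) + of_bool (h 1 \<in> C) :: nat)
      = 1 + 2 * (\<Sum>h\<in>\<Delta> - {g}. of_bool (h 0 \<in> I))"
    using this_line by (cases "g 0 \<in> I") (simp_all add: sum_distrib_left)
  moreover have "even (\<Sum>C\<in>\<H>. \<Sum>h\<in>\<Delta>. of_bool (h 0 \<in> C) + of_bool (h 1 \<in> C) :: nat)"
    by (rule dvd_sum) (use even_hole holes in blast)
  ultimately show False by simp
qed

text \<open>
Otherwise the path alone would be a family with an even number of ends, 0 or 2, at each hole.
\<close>

lemma slits_ends_in_distinct_components:
  fixes \<Omega> :: "(real ^ 2) set"
  assumes "open \<Omega>" "bounded \<Omega>" "smooth_boundary \<Omega>" "slits \<Gamma> \<Omega>" "h \<in> \<Gamma>"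
    and C: "C \<in> components (- \<Omega>)" "h 0 \<in> C"
  shows "h 1 \<notin> C"
proof
  assume "h 1 \<in> C"
  obtain H where H: "H \<in> holes \<Omega>" "odd (of_bool (h 0 \<in> H) + of_bool (h 1 \<in> H) :: nat)"
    using slits_subfamily_odd_at_some_hole[OF assms(1-4), of "{h}"] \<open>h \<in> \<Gamma>\<close> by auto
  then have "H \<in> components (- \<Omega>)" by (simp add: holes_def)
  then have "h 0 \<in> H \<longleftrightarrow> h 1 \<in> H" using components_nonoverlap[OF _ C(1)] C(2) \<open>h 1 \<in> C\<close> by blast
  then show False using H(2) by auto
qed

text \<open>
At each hole the number of additional lines \<open>\<Delta> = \<Gamma>' - \<Gamma>\<close> is a difference of two odd numbers. It is
also their number of ends there, as no line has both ends at the same hole. Hence \<open>\<Delta>\<close> has an even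
number of ends at each hole. It is finite, since every line has an end at one of the finitely many
holes, where only finitely many lines end.
\<close>

lemma slits_not_psubset:
  fixes \<Omega> :: "(real ^ 2) set"
  assumes \<Omega>: "open \<Omega>" "bounded \<Omega>" "smooth_boundary \<Omega>"
    and slits: "slits \<Gamma> \<Omega>" "slits \<Gamma>' \<Omega>"
  shows "\<not> \<Gamma> \<subset> \<Gamma>'"
proof
  assume psub: "\<Gamma> \<subset> \<Gamma>'"
  define lines_at :: "(real \<Rightarrow> real ^ 2) set \<Rightarrow> (real ^ 2) set \<Rightarrow> (real \<Rightarrow> real ^ 2) set"
    where "lines_at \<Delta> H = {h \<in> \<Delta>. h 0 \<in> H \<or> h 1 \<in> H}" for \<Delta> H
  have fr: "h 0 \<in> frontier \<Omega>" "h 1 \<in> frontier \<Omega>" if "h \<in> \<Gamma>'" for h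
    using slits(2) that unfolding slits_def pathstart_def pathfinish_def by blast+
  have "odd (card (lines_at \<Delta> H))" if H: "H \<in> holes \<Omega>" and \<Delta>: "\<Delta> \<subseteq> \<Gamma>'" "slits \<Delta> \<Omega>" for \<Delta> H
  proof -
    have "h 0 \<in> frontier H \<longleftrightarrow> h 0 \<in> H" "h 1 \<in> frontier H \<longleftrightarrow> h 1 \<in> H" if "h \<in> \<Delta>" for h
      using frontier_in_component[OF \<Omega>(1)] H fr that \<Delta>(1) unfolding holes_def by blast+
    then have "lines_at \<Delta> H = {h \<in> \<Delta>. pathstart h \<in> frontier H \<or> pathfinish h \<in> frontier H}"
      unfolding lines_at_def pathstart_def pathfinish_def by blast
    moreover have "frontier H \<in> interior_boundary_components \<Omega>"
      using H by (simp add: interior_boundary_components_def)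
    ultimately show ?thesis using \<Delta>(2) unfolding slits_def by simp
  qed
  then have odd_card: "odd (card (lines_at \<Gamma> H))" "odd (card (lines_at \<Gamma>' H))" if "H \<in> holes \<Omega>" for H
    using that psub slits by blast+
  have fin: "finite (lines_at \<Gamma>' H)" if "H \<in> holes \<Omega>" for H
    (* an infinite set has the even cardinality 0 *)
    using odd_card(2)[OF that] by (metis card.infinite even_zero)
  define \<Delta> where "\<Delta> = \<Gamma>' - \<Gamma>"
  have distinct: "h 1 \<notin> C" if "h \<in> \<Gamma>'" "C \<in> components (- \<Omega>)" "h 0 \<in> C" for h C
    using slits_ends_in_distinct_components[OF \<Omega> slits(2)] that by blast
  have even_at: "even (card (lines_at \<Delta> H))" if H: "H \<in> holes \<Omega>" for H
  proof -
    have "lines_at \<Delta> H = lines_at \<Gamma>' H - lines_at \<Gamma> H" unfolding lines_at_def \<Delta>_def by blast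
    moreover have sub: "lines_at \<Gamma> H \<subseteq> lines_at \<Gamma>' H" using psub unfolding lines_at_def by blast
    ultimately have "card (lines_at \<Delta> H) + card (lines_at \<Gamma> H) = card (lines_at \<Gamma>' H)"
      using fin[OF H] by (simp add: card_Diff_subset card_mono finite_subset)
    then show ?thesis using odd_card[OF H] by (metis even_add)
  qed
  have at_hole: "\<exists>H\<in>holes \<Omega>. h \<in> lines_at \<Gamma>' H" if h: "h \<in> \<Gamma>'" for h
  proof -
    have "h 0 \<in> - \<Omega>" "h 1 \<in> - \<Omega>" using fr[OF h] \<Omega>(1) by (auto simp: frontier_def interior_open)
    then obtain C0 C1 where C: "C0 \<in> components (- \<Omega>)" "h 0 \<in> C0" "C1 \<in> components (- \<Omega>)" "h 1 \<in> C1"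
      using Union_components[of "- \<Omega>"] by blast
    have "C0 \<noteq> C1" using distinct[OF h C(1,2)] C(4) by blast
    then have "bounded C0 \<or> bounded C1"
      using cobounded_unique_unbounded_components[of "- \<Omega>" C0 C1] C(1,3) \<Omega>(2) by auto
    then show ?thesis using C h unfolding holes_def lines_at_def by blast
  qed
  obtain g where "g \<in> \<Delta>" using psub unfolding \<Delta>_def by blast
  have "\<Omega> \<noteq> {}" using fr(1)[of g] \<open>g \<in> \<Delta>\<close> unfolding \<Delta>_def by auto
  then have "finite (holes \<Omega>)"
    using finite_components_complement[OF \<Omega>(1,2) _ \<Omega>(3)] by (simp add: holes_def)
  then have "finite (\<Union>H\<in>holes \<Omega>. lines_at \<Gamma>' H)" using fin by blast
  moreover have "\<Delta> \<subseteq> (\<Union>H\<in>holes \<Omega>. lines_at \<Gamma>' H)" using at_hole unfolding \<Delta>_def by blast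
  ultimately have "finite \<Delta>" by (rule rev_finite_subset)
  obtain H where H: "H \<in> holes \<Omega>" "odd (\<Sum>h\<in>\<Delta>. of_bool (h 0 \<in> H) + of_bool (h 1 \<in> H) :: nat)"
    using slits_subfamily_odd_at_some_hole[OF \<Omega> slits(2) _ \<open>finite \<Delta>\<close>] \<open>g \<in> \<Delta>\<close>
    unfolding \<Delta>_def by blast
  have "of_bool (h 0 \<in> H) + of_bool (h 1 \<in> H) = (of_bool (h 0 \<in> H \<or> h 1 \<in> H) :: nat)" if "h \<in> \<Delta>" for h
    using distinct[of h H] that H(1) unfolding \<Delta>_def holes_def by auto
  then have "(\<Sum>h\<in>\<Delta>. of_bool (h 0 \<in> H) + of_bool (h 1 \<in> H) :: nat) = (\<Sum>h\<in>\<Delta>. of_bool (h 0 \<in> H \<or> h 1 \<in> H))"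
    by (rule sum.cong[OF refl])
  also have "\<dots> = card (\<Delta> \<inter> {h. h 0 \<in> H \<or> h 1 \<in> H})"
    by (simp add: of_bool_def sum.If_cases[OF \<open>finite \<Delta>\<close>])
  also have "\<Delta> \<inter> {h. h 0 \<in> H \<or> h 1 \<in> H} = lines_at \<Delta> H" by (auto simp: lines_at_def)
  finally show False using H even_at by simp
qed

theorem corollary4p3:
  fixes \<Omega> :: "(real ^ 2) set" and k :: nat and \<Gamma> :: "(real \<Rightarrow> real ^ 2) set"
  assumes "smooth_region_with_holes k \<Omega>"
    and "slits \<Gamma> \<Omega>"
  shows "(\<forall>\<Gamma>'. \<Gamma>' \<subset> \<Gamma> \<longrightarrow> \<not> slits \<Gamma>' \<Omega>) \<and> (\<forall>\<Gamma>'. \<Gamma> \<subset> \<Gamma>' \<longrightarrow> \<not> slits \<Gamma>' \<Omega>)"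
proof -
  have "open \<Omega>" "bounded \<Omega>" "smooth_boundary \<Omega>"
    using assms(1) unfolding smooth_region_with_holes_def by blast+
  then show ?thesis using slits_not_psubset assms(2) by blast
qed

end
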